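(* $C_5(3)=3$. That is, $\limsup_{t\to\infty} \frac{N_5(t,3)}{\log_2 t} = 3$, where $N_5(t,3)$ is the minimal worst-case total number of tests needed to find all $3$ defective elements among $t$ samples by an algorithm using at most $5$ stages.
   Context: Group testing model: there are $t$ samples, indexed by $[t]=\{1,\dots,t\}$, among which an unknown set $S_{un}$ of exactly $s$ samples is defective. A test is performed on a chosen subset $T\subseteq[t]$; its outcome is positive (1) if $T\cap S_{un}\neq\emptyset$ and negative (0) otherwise; outcomes are always correct (noiseless). A $p$-stage algorithm is divided into $p$ stages; the tests of stage $i$ are all chosen before any test of stage $i$ is performed, and may depend on the outcomes of all tests from stages $1,\dots,i-1$. The algorithm must determine $S_{un}$ exactly for every possible $S_{un}$ with $|S_{un}|=s$. $N_p(t,s)$ denotes the minimal, over all $p$-stage algorithms, worst-case (over $S_{un}$) total number of tests, and $C_p(s)=\limsup_{t\to\infty} N_p(t,s)/\log_2 t$. *)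

theory Defs
  imports Complex_Main "HOL-Library.Liminf_Limsup" "HOL-Library.Extended_Real"
begin

text \<open>A p-stage group testing algorithm is modelled as a map A from the history of
outcomes of all previous stages (one outcome list per completed stage) to the list of
tests (subsets of the samples) of the next stage.  Samples are {1..t}.\<close>

type_synonym gt_alg = "bool list list \<Rightarrow> nat set list"

fun gt_run :: "gt_alg \<Rightarrow> nat set \<Rightarrow> nat \<Rightarrow> bool list list" where
  "gt_run A S 0 = []"
| "gt_run A S (Suc i) =
     (let h = gt_run A S i in h @ [map (\<lambda>T. T \<inter> S \<noteq> {}) (A h)])"

definition gt_num_tests :: "gt_alg \<Rightarrow> nat set \<Rightarrow> nat \<Rightarrow> nat" where
  "gt_num_tests A S p = sum_list (map length (gt_run A S p))"

definition gt_cands :: "nat \<Rightarrow> nat \<Rightarrow> nat set set" where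
  "gt_cands t s = {S. S \<subseteq> {1..t} \<and> card S = s}"

definition gt_valid :: "nat \<Rightarrow> nat \<Rightarrow> nat \<Rightarrow> gt_alg \<Rightarrow> nat \<Rightarrow> bool" where
  "gt_valid p t s A k \<longleftrightarrow>
     (\<forall>h. \<forall>T\<in>set (A h). T \<subseteq> {1..t}) \<and>
     inj_on (\<lambda>S. gt_run A S p) (gt_cands t s) \<and>
     (\<forall>S\<in>gt_cands t s. gt_num_tests A S p \<le> k)"

definition N_gt :: "nat \<Rightarrow> nat \<Rightarrow> nat \<Rightarrow> nat" where
  "N_gt p t s = (LEAST k. \<exists>A. gt_valid p t s A k)"

definition C_gt :: "nat \<Rightarrow> nat \<Rightarrow> ereal" where
  "C_gt p s = limsup (\<lambda>t. ereal (real (N_gt p t s) / log 2 (real t)))"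

end

theory Submission
  imports Defs "HOL-Library.FuncSet" "HOL-Real_Asymp.Real_Asymp"
begin

text \<open>The lower bound is the counting bound: an algorithm with at most \<open>k\<close> tests distinguishes at
most \<open>2 ^ k\<close> sets.

For the upper bound three stages suffice.  Put \<open>\<lambda> = 2 powr (1/3) - 1\<close>, the odds for which three
independent random subsets leave a test negative with probability \<open>1/2\<close>.  Label the samples by
random \<open>w\<close>-subsets of \<open>{..<N}\<close>, where \<open>w\<close> is the mode of \<open>(N choose w) \<lambda> ^ w\<close> and
\<open>t \<approx> 2 powr (N/3) * 1.025 ^ w\<close>; stage one tests, for each \<open>i < N\<close>, the samples whose label
contains \<open>i\<close>, so it reveals the union \<open>r\<close> of the three labels.  A union bound over all \<open>r\<close> shows that
with positive probability every hypergraph of consistent triples has at most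
\<open>M \<approx> 1.025 ^ (3w) \<approx> t ^ 3 / 2 ^ N\<close> disjoint edges and pair degrees at most \<open>M\<close>, that the link of every
vertex has a bounded matching number, and that pairs of large degree have a bounded matching number
(a pair whose labels leave much of \<open>r\<close> uncovered has bounded degree, and few disjoint
pairs cover almost all of \<open>r\<close>).  Stage two tests the boundedly many vertices in pairs of large degree
one by one, together with the colour classes of a bounded colouring of the remaining
bounded-degree hypergraph.  What is then left is a matching, or the unknown third member of
a known pair, and \<open>log 2 M\<close> nonadaptive tests finish, for a total of
\<open>N + log 2 M + o(log t) = 3 log 2 t + o(log t)\<close>.\<close>

section \<open>Algorithms as decision trees\<close>

definition outcome :: "nat set list \<Rightarrow> nat set \<Rightarrow> bool list" where
  "outcome Ts S = map (\<lambda>T. T \<inter> S \<noteq> {}) Ts"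

lemma length_outcome [simp]: "length (outcome Ts S) = length Ts"
  by (simp add: outcome_def)

text \<open>The recursion of \<open>gt_run\<close> exposes the last stage. Induction needs the first
  one, after which the run is that of the same algorithm with the first outcome fixed as head of the
  history.\<close>

lemma gt_run_shift:
  "gt_run A S (Suc p) = outcome (A []) S # gt_run (\<lambda>h. A (outcome (A []) S # h)) S p"
proof (induction p)
  case (Suc p)
  have "gt_run A S (Suc (Suc p)) = gt_run A S (Suc p) @ [outcome (A (gt_run A S (Suc p))) S]"
    by (simp only: gt_run.simps(2)[of A S "Suc p"] Let_def outcome_def)
  then show ?case by (simp only: Suc) (simp add: Let_def outcome_def)
qed (simp add: outcome_def)

lemma gt_num_tests_shift:
  "gt_num_tests A S (Suc p) =
     length (A []) + gt_num_tests (\<lambda>h. A (outcome (A []) S # h)) S p"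
  by (simp only: gt_num_tests_def gt_run_shift) simp

text \<open>Leaves of a decision tree: a first stage with \<open>n\<close> tests has at most
  \<open>2 ^ n\<close> outcomes, and behind each of them only \<open>k - n\<close> tests
  remain.\<close>

lemma card_runs_le:
  assumes "finite C" "\<And>S. S \<in> C \<Longrightarrow> gt_num_tests A S p \<le> k"
  shows "card ((\<lambda>S. gt_run A S p) ` C) \<le> 2 ^ k"
  using assms
proof (induction p arbitrary: A C k)
  case 0
  have "card ((\<lambda>S. gt_run A S 0) ` C) \<le> card {[] :: bool list list}"
    by (intro card_mono) auto
  also have "\<dots> \<le> 2 ^ k" by simp
  finally show ?case .
next
  case (Suc p)
  define n where "n = length (A [])"
  define Q where "Q = {q :: bool list. set q \<subseteq> UNIV \<and> length q = n}"
  define G where "G q = (\<lambda>S. gt_run (\<lambda>h. A (q # h)) S p) ` {S \<in> C. outcome (A []) S = q}" for q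
  have Q: "finite Q" "card Q = 2 ^ n"
    unfolding Q_def
    by (intro finite_lists_length_eq finite_UNIV, subst card_lists_length_eq) simp_all
  show ?case
  proof (cases "C = {}")
    case False
    then obtain S0 where "S0 \<in> C" by auto
    with Suc.prems(2)[of S0] have nk: "n \<le> k"
      unfolding gt_num_tests_shift n_def by simp
    have G: "card (G q) \<le> 2 ^ (k - n)" for q
      unfolding G_def
    proof (rule Suc.IH)
      fix S assume "S \<in> {S \<in> C. outcome (A []) S = q}"
      with Suc.prems(2)[of S] show "gt_num_tests (\<lambda>h. A (q # h)) S p \<le> k - n"
        unfolding gt_num_tests_shift n_def by auto
    qed (use Suc.prems in auto)
    have fin: "finite (G q)" for q using Suc.prems unfolding G_def by auto
    have "(\<lambda>S. gt_run A S (Suc p)) ` C \<subseteq> (\<Union>q\<in>Q. (#) q ` G q)"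
      unfolding gt_run_shift G_def Q_def n_def by (force intro!: imageI)
    then have "card ((\<lambda>S. gt_run A S (Suc p)) ` C) \<le> card (\<Union>q\<in>Q. (#) q ` G q)"
      by (intro card_mono) (auto simp: Q fin)
    also have "\<dots> \<le> (\<Sum>q\<in>Q. card ((#) q ` G q))"
      by (rule card_UN_le[OF Q(1)])
    also have "\<dots> \<le> (\<Sum>q\<in>Q. 2 ^ (k - n))"
      by (intro sum_mono order.trans[OF card_image_le[OF fin] G])
    also have "\<dots> = 2 ^ k" using Q nk by (simp flip: power_add)
    finally show ?thesis .
  qed simp
qed

lemma finite_gt_cands: "finite (gt_cands t s)"
  unfolding gt_cands_def by (rule finite_subset[of _ "Pow {1..t}"]) auto

lemma gt_valid_lower:
  assumes "gt_valid p t s A k"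
  shows "t choose s \<le> 2 ^ k"
proof -
  have "t choose s = card (gt_cands t s)"
    unfolding gt_cands_def using n_subsets[of "{1..t}" s] by simp
  also have "\<dots> = card ((\<lambda>S. gt_run A S p) ` gt_cands t s)"
    using assms unfolding gt_valid_def by (intro card_image[symmetric]) auto
  also have "\<dots> \<le> 2 ^ k"
    using assms finite_gt_cands unfolding gt_valid_def by (intro card_runs_le) auto
  finally show ?thesis .
qed

text \<open>A decision tree seen through the family \<open>E\<close> of sets still possible: each
  outcome \<open>q\<close> of a stage cuts \<open>E\<close> down to the sets producing
  \<open>q\<close>, and at most one set may be left at the end. Families instead of histories make
  it easy to compose stages.\<close>

fun solvable :: "nat \<Rightarrow> nat \<Rightarrow> nat \<Rightarrow> nat set set \<Rightarrow> bool" where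
  "solvable t 0 k E \<longleftrightarrow> (\<forall>S\<in>E. \<forall>S'\<in>E. S = S')"
| "solvable t (Suc p) k E \<longleftrightarrow>
     (\<exists>Ts. (\<forall>T\<in>set Ts. T \<subseteq> {1..t}) \<and> length Ts \<le> k \<and>
        (\<forall>q. solvable t p (k - length Ts) {S \<in> E. outcome Ts S = q}))"

lemma solvable_subset: "solvable t p k E \<Longrightarrow> E' \<subseteq> E \<Longrightarrow> solvable t p k E'"
proof (induction p arbitrary: k E E')
  case (Suc p)
  then obtain Ts where Ts: "\<forall>T\<in>set Ts. T \<subseteq> {1..t}" "length Ts \<le> k"
    "\<And>q. solvable t p (k - length Ts) {S \<in> E. outcome Ts S = q}" by auto
  have "solvable t p (k - length Ts) {S \<in> E'. outcome Ts S = q}" for q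
    using Ts(3)[of q] by (rule Suc.IH) (use Suc.prems in auto)
  with Ts show ?case by auto
qed (simp, blast)

lemma solvable_mono: "solvable t p k E \<Longrightarrow> k \<le> k' \<Longrightarrow> solvable t p k' E"
proof (induction p arbitrary: k k' E)
  case (Suc p)
  then obtain Ts where Ts: "\<forall>T\<in>set Ts. T \<subseteq> {1..t}" "length Ts \<le> k"
    "\<And>q. solvable t p (k - length Ts) {S \<in> E. outcome Ts S = q}" by auto
  have "solvable t p (k' - length Ts) {S \<in> E. outcome Ts S = q}" for q
    using Ts(3)[of q] by (rule Suc.IH) (use Suc.prems in auto)
  with Ts Suc.prems show ?case by (auto intro!: exI[of _ Ts])
qed simp

lemma solvable_Suc: "solvable t p k E \<Longrightarrow> solvable t (Suc p) k E"
  by (auto intro!: exI[of _ "[]"] elim: solvable_subset)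

lemma solvable_split:
  assumes "\<And>T. T \<in> set Ts \<Longrightarrow> T \<subseteq> {1..t}"
    and "\<And>q. solvable t p k {S \<in> E. outcome Ts S = q}"
  shows "solvable t (Suc p) (length Ts + k) E"
  using assms by (auto intro!: exI[of _ Ts])

text \<open>Choose an algorithm \<open>B q\<close> for each outcome \<open>q\<close> of the first
  stage; the combined algorithm reads \<open>q\<close> off the head of the history and passes the
  tail to \<open>B q\<close>.\<close>

lemma solvable_imp_alg:
  assumes "solvable t p k E"
  shows "\<exists>A. (\<forall>h. \<forall>T\<in>set (A h). T \<subseteq> {1..t}) \<and> inj_on (\<lambda>S. gt_run A S p) E \<and>
           (\<forall>S\<in>E. gt_num_tests A S p \<le> k)"
  using assms
proof (induction p arbitrary: k E)
  case 0
  then show ?case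
    by (intro exI[of _ "\<lambda>_. []"]) (auto simp: inj_on_def gt_num_tests_def)
next
  case (Suc p)
  then obtain Ts where Ts: "\<forall>T\<in>set Ts. T \<subseteq> {1..t}" "length Ts \<le> k"
    "\<And>q. solvable t p (k - length Ts) {S \<in> E. outcome Ts S = q}" by auto
  have "\<forall>q. \<exists>A. (\<forall>h. \<forall>T\<in>set (A h). T \<subseteq> {1..t}) \<and>
      inj_on (\<lambda>S. gt_run A S p) {S \<in> E. outcome Ts S = q} \<and>
      (\<forall>S\<in>{S \<in> E. outcome Ts S = q}. gt_num_tests A S p \<le> k - length Ts)"
    using Suc.IH[OF Ts(3)] by (rule allI)
  from choice[OF this] obtain B where "\<forall>q. (\<forall>h. \<forall>T\<in>set (B q h). T \<subseteq> {1..t}) \<and>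
      inj_on (\<lambda>S. gt_run (B q) S p) {S \<in> E. outcome Ts S = q} \<and>
      (\<forall>S\<in>{S \<in> E. outcome Ts S = q}. gt_num_tests (B q) S p \<le> k - length Ts)" ..
  then have B: "\<And>q h T. T \<in> set (B q h) \<Longrightarrow> T \<subseteq> {1..t}"
    "\<And>q. inj_on (\<lambda>S. gt_run (B q) S p) {S \<in> E. outcome Ts S = q}"
    "\<And>q S. S \<in> E \<Longrightarrow> outcome Ts S = q \<Longrightarrow> gt_num_tests (B q) S p \<le> k - length Ts"
    by simp_all
  define A where "A h = (case h of [] \<Rightarrow> Ts | q # h' \<Rightarrow> B q h')" for h
  have A: "A [] = Ts" "(\<lambda>h. A (q # h)) = B q" for q
    by (auto simp: A_def)
  show ?case
  proof (intro exI[of _ A] conjI ballI allI)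
    fix h T assume "T \<in> set (A h)"
    then show "T \<subseteq> {1..t}"
      using Ts(1) B(1) by (auto simp: A_def split: list.splits)
  next
    show "inj_on (\<lambda>S. gt_run A S (Suc p)) E"
    proof (rule inj_onI)
      fix S S' assume S: "S \<in> E" "S' \<in> E" and eq: "gt_run A S (Suc p) = gt_run A S' (Suc p)"
      from eq have "outcome Ts S = outcome Ts S'"
        "gt_run (B (outcome Ts S)) S p = gt_run (B (outcome Ts S)) S' p"
        unfolding gt_run_shift A by auto
      with B(2)[of "outcome Ts S"] S show "S = S'" by (auto dest: inj_onD)
    qed
  next
    fix S assume "S \<in> E"
    with B(3)[of S] Ts(2) show "gt_num_tests A S (Suc p) \<le> k"
      unfolding gt_num_tests_shift A by fastforce
  qed
qed

lemma solvable_imp_gt_valid: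
  "solvable t p k (gt_cands t s) \<Longrightarrow> \<exists>A. gt_valid p t s A k"
  unfolding gt_valid_def by (rule solvable_imp_alg)

section \<open>Hypergraphs with bounded links\<close>

lemma greedy_colouring:
  fixes N :: "'a \<Rightarrow> 'a \<Rightarrow> bool"
  assumes "finite V" and sym: "\<And>u v. N u v \<Longrightarrow> N v u"
    and "\<And>v. v \<in> V \<Longrightarrow> card {u \<in> V. N v u} \<le> d"
  shows "\<exists>col :: 'a \<Rightarrow> nat. (\<forall>v\<in>V. col v \<le> d) \<and>
           (\<forall>u\<in>V. \<forall>v\<in>V. u \<noteq> v \<and> N u v \<longrightarrow> col u \<noteq> col v)"
  using assms(1,3)
proof (induction V rule: finite_induct)
  case (insert x V)
  have "card {u \<in> V. N v u} \<le> d" if "v \<in> V" for v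
  proof -
    have "card {u \<in> V. N v u} \<le> card {u \<in> insert x V. N v u}"
      using insert.hyps by (intro card_mono) auto
    also have "\<dots> \<le> d" using that by (intro insert.prems) auto
    finally show ?thesis .
  qed
  then obtain col :: "'a \<Rightarrow> nat" where col: "\<forall>v\<in>V. col v \<le> d"
    "\<forall>u\<in>V. \<forall>v\<in>V. u \<noteq> v \<and> N u v \<longrightarrow> col u \<noteq> col v"
    using insert.IH by auto
  define F where "F = col ` {u \<in> V. N x u}"
  have "card F \<le> card {u \<in> V. N x u}"
    unfolding F_def using insert.hyps by (intro card_image_le) auto
  also have "\<dots> \<le> card {u \<in> insert x V. N x u}"
    using insert.hyps by (intro card_mono) auto
  also have "\<dots> \<le> d" by (intro insert.prems) auto
  finally have "card F < card {..d}" by simp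
  then have "\<not> {..d} \<subseteq> F"
    using insert.hyps card_mono[of F "{..d}"] by (auto simp: F_def)
  then obtain c where c: "c \<le> d" "c \<notin> F" by auto
  show ?case
  proof (intro exI[of _ "col(x := c)"] conjI ballI impI)
    fix u v assume "u \<in> insert x V" "v \<in> insert x V" "u \<noteq> v \<and> N u v"
    with col c insert.hyps sym[of u v] show "(col(x := c)) u \<noteq> (col(x := c)) v"
      unfolding F_def by (auto split: if_splits)
  qed (use col c insert.hyps in auto)
qed simp

text \<open>A disjoint subfamily of maximal size cannot be enlarged, so every member of
  \<open>P\<close> meets its union, which has at most \<open>K * m\<close> points.\<close>

lemma hitting_set:
  assumes "finite P" and P: "\<And>e. e \<in> P \<Longrightarrow> finite e \<and> e \<noteq> {} \<and> card e \<le> m"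
    and disj: "\<And>F. F \<subseteq> P \<Longrightarrow> pairwise disjnt F \<Longrightarrow> card F \<le> K"
  shows "\<exists>Y. finite Y \<and> card Y \<le> K * m \<and> Y \<subseteq> \<Union>P \<and> (\<forall>e\<in>P. e \<inter> Y \<noteq> {})"
proof -
  define Fs where "Fs = {F. F \<subseteq> P \<and> pairwise disjnt F}"
  have "finite Fs" "{} \<in> Fs"
    using assms(1) by (auto simp: Fs_def)
  then obtain F where F: "F \<in> Fs" "\<And>G. G \<in> Fs \<Longrightarrow> card G \<le> card F"
    using Max_in[of "card ` Fs"] Max_ge[of "card ` Fs"] by fastforce
  have fin: "finite F" using F(1) assms(1) by (auto simp: Fs_def intro: finite_subset)
  have "card (\<Union>F) \<le> (\<Sum>e\<in>F. card e)"
    by (rule card_Union_le_sum_card)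
  also have "\<dots> \<le> card F * m"
    using sum_bounded_above[of F card m] P F(1) by (auto simp: Fs_def)
  also have "\<dots> \<le> K * m"
    using disj[of F] F(1) by (auto simp: Fs_def)
  finally have "card (\<Union>F) \<le> K * m" .
  moreover have "e \<inter> \<Union>F \<noteq> {}" if "e \<in> P" for e
  proof
    assume e: "e \<inter> \<Union>F = {}"
    have "e \<notin> F" using e P[OF that] by auto
    moreover have "insert e F \<in> Fs"
      using F(1) e that by (auto simp: Fs_def pairwise_insert disjnt_def)
    ultimately show False using F(2)[of "insert e F"] fin by simp
  qed
  moreover have "finite (\<Union>F)" "\<Union>F \<subseteq> \<Union>P"
    using fin F(1) P by (auto simp: Fs_def)
  ultimately show ?thesis by blast
qed

text \<open>Number the members of \<open>F\<close> in binary and let test \<open>j\<close> collect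
  the points outside \<open>B\<close> of the members whose number has bit \<open>j\<close>. By
  disjointness a member meets test \<open>j\<close> only in its own points, so the \<open>n\<close>
  outcomes spell its number.\<close>

lemma solvable_binary:
  assumes "finite F" "card F \<le> 2 ^ n"
    and F: "\<And>S. S \<in> F \<Longrightarrow> S \<subseteq> {1..t} \<and> S - B \<noteq> {}"
    and disj: "\<And>S S'. S \<in> F \<Longrightarrow> S' \<in> F \<Longrightarrow> S \<noteq> S' \<Longrightarrow> (S - B) \<inter> (S' - B) = {}"
  shows "solvable t (Suc 0) n F"
proof -
  obtain idx where idx: "inj_on idx F" "idx ` F \<subseteq> {..<(2::nat) ^ n}"
    using assms(1,2) card_le_inj[of F "{..<(2::nat) ^ n}"] by auto
  define T where "T j = \<Union>{S - B |S. S \<in> F \<and> bit (idx S) j}" for j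
  define Ts where "Ts = map T [0..<n]"
  have T: "T j \<inter> S \<noteq> {} \<longleftrightarrow> bit (idx S) j" if S: "S \<in> F" for S j
  proof
    assume "T j \<inter> S \<noteq> {}"
    then obtain x S' where x: "x \<in> S" "x \<in> S' - B" "S' \<in> F" "bit (idx S') j"
      unfolding T_def by auto
    then have "S = S'" using disj[OF S x(3)] by blast
    with x show "bit (idx S) j" by simp
  next
    assume "bit (idx S) j"
    then have "S - B \<subseteq> T j" using S unfolding T_def by auto
    then show "T j \<inter> S \<noteq> {}" using F[OF S] by blast
  qed
  have "S = S'" if S: "S \<in> F" "S' \<in> F" and eq: "outcome Ts S = outcome Ts S'" for S S'
  proof -
    have "bit (idx S) j = bit (idx S') j" if "j < n" for j
      using eq T[OF S(1), of j] T[OF S(2), of j] that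
      unfolding outcome_def Ts_def by (auto simp: list_eq_iff_nth_eq)
    then have "take_bit n (idx S) = take_bit n (idx S')"
      by (intro bit_eqI) (auto simp: bit_take_bit_iff)
    then have "idx S = idx S'"
      using idx(2) S by (subst (asm) (1 2) take_bit_nat_eq_self) auto
    with idx(1) S show ?thesis by (auto dest: inj_onD)
  qed
  moreover have "\<forall>U\<in>set Ts. U \<subseteq> {1..t}"
    using F unfolding Ts_def T_def by auto
  moreover have "length Ts = n" by (simp add: Ts_def)
  ultimately show ?thesis by (auto intro!: exI[of _ Ts])
qed

section \<open>Heavy pairs and light edges\<close>

definition edge_deg :: "nat set set \<Rightarrow> nat set \<Rightarrow> nat" where
  "edge_deg H p = card {e \<in> H. p \<subseteq> e}"

definition heavy :: "nat set set \<Rightarrow> nat \<Rightarrow> nat set set" where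
  "heavy H K = {p. card p = 2 \<and> edge_deg H p > K}"

definition link :: "nat set set \<Rightarrow> nat \<Rightarrow> nat set set" where
  "link H v = {e - {v} |e. e \<in> H \<and> v \<in> e}"

text \<open>What random labels guarantee about the triples consistent with stage one.
  \<open>K\<close> is a constant, so any number of tests depending on \<open>K\<close> alone is
  affordable; \<open>M\<close> grows with \<open>t\<close> and may cost only about
  \<open>log 2 M\<close> tests.\<close>

locale hypergraph3 =
  fixes t :: nat and H :: "nat set set" and K M :: nat
  assumes edges: "\<And>e. e \<in> H \<Longrightarrow> e \<subseteq> {1..t} \<and> card e = 3"
    and matching: "\<And>F. F \<subseteq> H \<Longrightarrow> pairwise disjnt F \<Longrightarrow> card F \<le> M"
    and link_matching: "\<And>v F. F \<subseteq> link H v \<Longrightarrow> pairwise disjnt F \<Longrightarrow> card F \<le> K"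
    and pair_deg: "\<And>p. card p = 2 \<Longrightarrow> edge_deg H p \<le> M"
    and heavy_matching: "\<And>F. F \<subseteq> heavy H (K * 2) \<Longrightarrow> pairwise disjnt F \<Longrightarrow> card F \<le> K"
begin

lemma finite_H: "finite H"
  using edges by (intro finite_subset[of H "Pow {1..t}"]) auto

lemma link_cover:
  "\<exists>Y. finite Y \<and> card Y \<le> K * 2 \<and> v \<notin> Y \<and> (\<forall>e\<in>H. v \<in> e \<longrightarrow> e \<inter> Y \<noteq> {})"
proof -
  have "\<exists>Y. finite Y \<and> card Y \<le> K * 2 \<and> Y \<subseteq> \<Union>(link H v) \<and> (\<forall>e\<in>link H v. e \<inter> Y \<noteq> {})"
  proof (rule hitting_set)
    show "finite (link H v)"
      using finite_H unfolding link_def by simp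
    fix e assume "e \<in> link H v"
    then obtain e' where e': "e = e' - {v}" "e' \<in> H" "v \<in> e'" by (auto simp: link_def)
    with edges[of e'] have "card e = 2" by (simp add: finite_subset card_Diff_singleton)
    then show "finite e \<and> e \<noteq> {} \<and> card e \<le> 2"
      by (auto intro: card_ge_0_finite)
  qed (rule link_matching)
  then obtain Y where Y: "finite Y" "card Y \<le> K * 2" "Y \<subseteq> \<Union>(link H v)"
    "\<forall>e\<in>link H v. e \<inter> Y \<noteq> {}" by auto
  have "e \<inter> Y \<noteq> {}" if "e \<in> H" "v \<in> e" for e
  proof -
    have "e - {v} \<in> link H v" using that by (auto simp: link_def)
    with Y(4) show ?thesis by auto
  qed
  moreover have "v \<notin> Y" using Y(3) by (auto simp: link_def)
  ultimately show ?thesis using Y(1,2) by (intro exI[of _ Y]) simp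
qed

lemma edge_third:
  assumes "e \<in> H" "a \<in> e" "b \<in> e" "c \<in> e" "a \<noteq> b" "a \<noteq> c" "b \<noteq> c"
  shows "e = {a, b, c}"
proof -
  have "card {a, b, c} = 3" using assms by simp
  with edges[OF assms(1)] assms show ?thesis
    by (intro card_subset_eq[symmetric]) (auto intro: finite_subset)
qed

text \<open>If \<open>b\<close> lies outside the cover \<open>Y\<close> of the link of
  \<open>a\<close>, each edge through \<open>a\<close> and \<open>b\<close> has its third vertex in
  \<open>Y\<close>, so the pair has degree at most \<open>K * 2\<close>. This is where the threshold
  for heavy pairs comes from.\<close>

lemma card_heavy_partners:
  "finite {b. {a, b} \<in> heavy H (K * 2)}" "card {b. {a, b} \<in> heavy H (K * 2)} \<le> K * 2"
proof -
  obtain Y where Y: "finite Y" "card Y \<le> K * 2" "a \<notin> Y" "\<And>e. e \<in> H \<Longrightarrow> a \<in> e \<Longrightarrow> e \<inter> Y \<noteq> {}"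
    using link_cover[of a] by auto
  have sub: "{b. {a, b} \<in> heavy H (K * 2)} \<subseteq> Y"
  proof safe
    fix b assume b: "{a, b} \<in> heavy H (K * 2)"
    show "b \<in> Y"
    proof (rule ccontr)
      assume nb: "b \<notin> Y"
      from b have ab: "a \<noteq> b" by (auto simp: heavy_def)
      have "{e \<in> H. {a, b} \<subseteq> e} \<subseteq> (\<lambda>c. {a, b, c}) ` Y"
      proof safe
        fix e assume e: "e \<in> H" "{a, b} \<subseteq> e"
        with Y(4)[of e] obtain c where c: "c \<in> e" "c \<in> Y" by auto
        with e ab nb Y(3) have "e = {a, b, c}" by (intro edge_third) auto
        with c show "e \<in> (\<lambda>c. {a, b, c}) ` Y" by auto
      qed
      then have "edge_deg H {a, b} \<le> card Y"
        unfolding edge_deg_def using Y(1) by (rule surj_card_le[rotated])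
      with b Y(2) show False by (auto simp: heavy_def)
    qed
  qed
  show "finite {b. {a, b} \<in> heavy H (K * 2)}" using sub Y(1) by (rule finite_subset)
  show "card {b. {a, b} \<in> heavy H (K * 2)} \<le> K * 2"
    using card_mono[OF Y(1) sub] Y(2) by simp
qed

lemma heavy_pair_subset: "p \<in> heavy H k \<Longrightarrow> p \<subseteq> {1..t}"
proof -
  assume "p \<in> heavy H k"
  then have "edge_deg H p \<noteq> 0" by (auto simp: heavy_def)
  then obtain e where "e \<in> H" "p \<subseteq> e" unfolding edge_deg_def by (auto simp: card_eq_0_iff)
  with edges show ?thesis by blast
qed

text \<open>The points of a maximal family of disjoint heavy pairs hit every heavy pair; adding
  their heavy partners captures both ends.\<close>

lemma heavy_vertices:
  "\<exists>U. finite U \<and> card U \<le> K * 2 + K * 2 * (K * 2) \<and> U \<subseteq> {1..t} \<and> \<Union>(heavy H (K * 2)) \<subseteq> U"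
proof -
  let ?P = "heavy H (K * 2)"
  have "\<exists>Z. finite Z \<and> card Z \<le> K * 2 \<and> Z \<subseteq> \<Union>?P \<and> (\<forall>e\<in>?P. e \<inter> Z \<noteq> {})"
  proof (rule hitting_set)
    show "finite ?P"
      by (rule finite_subset[of _ "Pow {1..t}"]) (use heavy_pair_subset in auto)
    fix e assume "e \<in> ?P"
    then have "card e = 2" by (auto simp: heavy_def)
    then show "finite e \<and> e \<noteq> {} \<and> card e \<le> 2" by (auto intro: card_ge_0_finite)
  qed (rule heavy_matching)
  then obtain Z where Z: "finite Z" "card Z \<le> K * 2" "Z \<subseteq> \<Union>?P" "\<And>e. e \<in> ?P \<Longrightarrow> e \<inter> Z \<noteq> {}"
    by blast
  define U where "U = Z \<union> (\<Union>a\<in>Z. {b. {a, b} \<in> ?P})"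
  have fin: "finite U" unfolding U_def using Z(1) card_heavy_partners by auto
  have "card (\<Union>a\<in>Z. {b. {a, b} \<in> ?P}) \<le> (\<Sum>a\<in>Z. card {b. {a, b} \<in> ?P})"
    by (rule card_UN_le[OF Z(1)])
  also have "\<dots> \<le> card Z * (K * 2)"
    using sum_bounded_above[of Z "\<lambda>a. card {b. {a, b} \<in> ?P}" "K * 2"] card_heavy_partners by simp
  also have "\<dots> \<le> K * 2 * (K * 2)" using Z(2) by simp
  finally have "card U \<le> K * 2 + K * 2 * (K * 2)"
    unfolding U_def by (intro order.trans[OF card_Un_le] add_mono Z(2))
  moreover have "U \<subseteq> {1..t}"
    unfolding U_def using Z(3) heavy_pair_subset by blast
  moreover have "\<Union>?P \<subseteq> U"
  proof safe
    fix p x assume p: "p \<in> ?P" "x \<in> p"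
    with Z(4)[of p] obtain a where a: "a \<in> p" "a \<in> Z" by auto
    show "x \<in> U"
    proof (cases "x = a")
      case False
      with p a have "{a, x} = p"
        by (intro card_subset_eq) (auto simp: heavy_def intro: card_ge_0_finite)
      with p a show ?thesis unfolding U_def by auto
    qed (use a in \<open>auto simp: U_def\<close>)
  qed
  ultimately show ?thesis using fin by blast
qed

definition light :: "nat set set" where
  "light = {e \<in> H. \<forall>p\<in>heavy H (K * 2). \<not> p \<subseteq> e}"

text \<open>Every edge at \<open>v\<close> meets the cover \<open>Y\<close> of its link in some
  \<open>b\<close>. A light edge through \<open>v\<close> and \<open>b\<close> exists only if that
  pair is not heavy, which leaves at most \<open>K * 2\<close> edges for each
  \<open>b\<close>.\<close>

lemma light_degree: "card {e \<in> light. v \<in> e} \<le> K * 2 * (K * 2)"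
proof -
  obtain Y where Y: "finite Y" "card Y \<le> K * 2" "v \<notin> Y" "\<And>e. e \<in> H \<Longrightarrow> v \<in> e \<Longrightarrow> e \<inter> Y \<noteq> {}"
    using link_cover[of v] by auto
  have fin: "finite light" using finite_H by (auto simp: light_def)
  have "{e \<in> light. v \<in> e} \<subseteq> (\<Union>b\<in>Y. {e \<in> light. {v, b} \<subseteq> e})"
    using Y(4) by (fastforce simp: light_def)
  then have "card {e \<in> light. v \<in> e} \<le> card (\<Union>b\<in>Y. {e \<in> light. {v, b} \<subseteq> e})"
    using Y(1) fin by (intro card_mono) auto
  also have "\<dots> \<le> (\<Sum>b\<in>Y. card {e \<in> light. {v, b} \<subseteq> e})"
    by (rule card_UN_le[OF Y(1)])
  also have "\<dots> \<le> card Y * (K * 2)"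
  proof -
    have "card {e \<in> light. {v, b} \<subseteq> e} \<le> K * 2" if "b \<in> Y" for b
    proof (cases "{v, b} \<in> heavy H (K * 2)")
      case True
      then have "{e \<in> light. {v, b} \<subseteq> e} = {}" by (auto simp: light_def)
      then show ?thesis by (metis card.empty le0)
    next
      case False
      from that Y(3) have "v \<noteq> b" by auto
      then have "card {v, b} = 2" by simp
      with False have "edge_deg H {v, b} \<le> K * 2" by (simp add: heavy_def)
      moreover have "card {e \<in> light. {v, b} \<subseteq> e} \<le> edge_deg H {v, b}"
        unfolding edge_deg_def using finite_H by (intro card_mono) (auto simp: light_def)
      ultimately show ?thesis by simp
    qed
    then show ?thesis
      using sum_bounded_above[of Y "\<lambda>b. card {e \<in> light. {v, b} \<subseteq> e}" "K * 2"] by simp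
  qed
  also have "\<dots> \<le> K * 2 * (K * 2)" using Y(2) by simp
  finally show ?thesis .
qed

text \<open>Vertices of the same colour in two intersecting edges must coincide, so edges with the same
  set of colours are disjoint.\<close>

definition conflict :: "nat \<Rightarrow> nat \<Rightarrow> bool" where
  "conflict u v \<longleftrightarrow> (\<exists>e\<in>light. \<exists>e'\<in>light. u \<in> e \<and> v \<in> e' \<and> e \<inter> e' \<noteq> {})"

lemma light_neighbours:
  assumes "finite X"
  shows "card (\<Union>x\<in>X. \<Union>{e \<in> light. x \<in> e}) \<le> card X * (K * 2 * (K * 2) * 3)"
proof -
  have "card (\<Union>{e \<in> light. x \<in> e}) \<le> K * 2 * (K * 2) * 3" for x
  proof -
    have "card (\<Union>{e \<in> light. x \<in> e}) \<le> (\<Sum>e\<in>{e \<in> light. x \<in> e}. card e)"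
      by (rule card_Union_le_sum_card)
    also have "\<dots> = card {e \<in> light. x \<in> e} * 3"
      using edges by (subst sum.cong[of _ _ _ "\<lambda>_. 3"]) (auto simp: light_def)
    also have "\<dots> \<le> K * 2 * (K * 2) * 3" using light_degree by simp
    finally show ?thesis .
  qed
  then have "(\<Sum>x\<in>X. card (\<Union>{e \<in> light. x \<in> e})) \<le> card X * (K * 2 * (K * 2) * 3)"
    using sum_bounded_above[of X "\<lambda>x. card (\<Union>{e \<in> light. x \<in> e})"] by simp
  then show ?thesis by (rule order.trans[OF card_UN_le[OF assms]])
qed

text \<open>Conflicting vertices are joined by two intersecting light edges, so the neighbourhood
  bound enters twice.\<close>

definition ncol :: nat where "ncol = (K * 2 * (K * 2) * 3) * (K * 2 * (K * 2) * 3)"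

lemma colouring:
  "\<exists>col :: nat \<Rightarrow> nat. (\<forall>v\<in>\<Union>light. col v \<le> ncol) \<and>
      (\<forall>u\<in>\<Union>light. \<forall>v\<in>\<Union>light. u \<noteq> v \<and> conflict u v \<longrightarrow> col u \<noteq> col v)"
proof (rule greedy_colouring)
  have fin: "finite e" if "e \<in> light" for e
    using that edges by (auto simp: light_def intro: finite_subset)
  have fl: "finite light" using finite_H by (auto simp: light_def)
  show "finite (\<Union>light)" using fl fin by auto
  show "conflict v u" if "conflict u v" for u v using that unfolding conflict_def by blast
  fix v assume "v \<in> \<Union>light"
  define X where "X = (\<Union>x\<in>{v}. \<Union>{e \<in> light. x \<in> e})"
  have X: "card X \<le> K * 2 * (K * 2) * 3" "finite X"
    using light_neighbours[of "{v}"] fl fin by (auto simp: X_def)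
  have "{u \<in> \<Union>light. conflict v u} \<subseteq> (\<Union>x\<in>X. \<Union>{e \<in> light. x \<in> e})"
    unfolding conflict_def X_def by blast
  then have "card {u \<in> \<Union>light. conflict v u} \<le> card (\<Union>x\<in>X. \<Union>{e \<in> light. x \<in> e})"
    using X(2) fl fin by (intro card_mono) auto
  also have "\<dots> \<le> card X * (K * 2 * (K * 2) * 3)" by (rule light_neighbours[OF X(2)])
  also have "\<dots> \<le> ncol" unfolding ncol_def using X(1) by (rule mult_right_mono) simp
  finally show "card {u \<in> \<Union>light. conflict v u} \<le> ncol" .
qed

lemma solvable_hypergraph:
  assumes "M \<le> 2 ^ n"
  shows "solvable t 2 (K * 2 + K * 2 * (K * 2) + ncol + 1 + n) H"
proof -
  obtain U where U: "finite U" "card U \<le> K * 2 + K * 2 * (K * 2)" "U \<subseteq> {1..t}"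
    "\<Union>(heavy H (K * 2)) \<subseteq> U" using heavy_vertices by (elim exE conjE)
  obtain col :: "nat \<Rightarrow> nat" where c: "\<forall>v\<in>\<Union>light. col v \<le> ncol"
    "\<forall>u\<in>\<Union>light. \<forall>v\<in>\<Union>light. u \<noteq> v \<and> conflict u v \<longrightarrow> col u \<noteq> col v"
    using colouring by (elim exE conjE)
  have col: "col v \<le> ncol" "conflict u v \<Longrightarrow> u \<noteq> v \<Longrightarrow> col u \<noteq> col v"
    if "u \<in> \<Union>light" "v \<in> \<Union>light" for u v
    using bspec[OF c(1) that(2)] bspec[OF bspec[OF c(2) that(1)] that(2)] by simp_all
  define Ts where "Ts = map (\<lambda>u. {u}) (sorted_list_of_set U) @
    map (\<lambda>c. {v \<in> \<Union>light. col v = c}) [0..<Suc ncol]"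
  have len: "length Ts \<le> K * 2 + K * 2 * (K * 2) + ncol + 1"
    using U(2) by (simp add: Ts_def)
  have sub: "T \<subseteq> {1..t}" if "T \<in> set Ts" for T
    using that U(1,3) edges unfolding Ts_def light_def by auto
  have outcome: "S \<inter> U = S' \<inter> U" "\<And>c. c \<le> ncol \<Longrightarrow>
      {v \<in> \<Union>light. col v = c} \<inter> S \<noteq> {} \<longleftrightarrow> {v \<in> \<Union>light. col v = c} \<inter> S' \<noteq> {}"
    if "outcome Ts S = outcome Ts S'" for S S'
  proof -
    from that have *: "T \<in> set Ts \<Longrightarrow> T \<inter> S \<noteq> {} \<longleftrightarrow> T \<inter> S' \<noteq> {}" for T
      unfolding outcome_def by simp
    show "{v \<in> \<Union>light. col v = c} \<inter> S \<noteq> {} \<longleftrightarrow> {v \<in> \<Union>light. col v = c} \<inter> S' \<noteq> {}"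
      if "c \<le> ncol" for c
      using that by (intro *) (auto simp: Ts_def)
    have "x \<in> S \<longleftrightarrow> x \<in> S'" if "x \<in> U" for x
      using *[of "{x}"] that U(1) unfolding Ts_def by auto
    then show "S \<inter> U = S' \<inter> U" by blast
  qed
  have "solvable t (Suc 0) n {S \<in> H. outcome Ts S = q}" for q
  proof (cases "\<exists>S0\<in>H. outcome Ts S0 = q")
    case False
    then show ?thesis by (intro solvable_subset[OF solvable_Suc, of t 0 n "{}"]) auto
  next
    case True
    define F where "F = {S \<in> H. outcome Ts S = q}"
    from True obtain S0 where S0: "S0 \<in> F" by (auto simp: F_def)
    define B where "B = S0 \<inter> U"
    have B: "S \<inter> U = B" if "S \<in> F" for S
      using that S0 outcome(1)[of S S0] by (auto simp: F_def B_def)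
    have FH: "S \<in> H" "S \<subseteq> {1..t}" "card S = 3" "finite S" if "S \<in> F" for S
      using that edges[of S] by (auto simp: F_def intro: finite_subset)
    have finF: "finite F" using finite_H by (auto simp: F_def)
    have finB: "finite B" "card B \<le> 3"
      using FH[OF S0] card_mono[of S0 B] by (auto simp: B_def)
    \<comment> \<open>\<open>B\<close> is the known part of the edge. With two known vertices the
      pair degree bounds the candidates; with at most one, no heavy pair fits inside the edge, since
      all heavy pairs lie in \<open>U\<close>, and the colouring applies.\<close>
    consider "card B = 3" | "card B = 2" | "card B \<le> 1" using finB by linarith
    then have "solvable t (Suc 0) n F"
    proof cases
      case 1
      have "S = B" if "S \<in> F" for S
        using B[OF that] FH[OF that] 1 by (intro card_subset_eq[symmetric]) auto
      then show ?thesis by (intro solvable_Suc) auto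
    next
      case 2
      have "F \<subseteq> {e \<in> H. B \<subseteq> e}" using B FH by auto
      then have "card F \<le> edge_deg H B"
        unfolding edge_deg_def using finite_H by (intro card_mono) auto
      also have "\<dots> \<le> 2 ^ n" using pair_deg[OF 2] assms by simp
      finally have cF: "card F \<le> 2 ^ n" .
      have one: "card (S - B) = 1" if "S \<in> F" for S
      proof -
        have "B \<subseteq> S" using B[OF that] by auto
        then show ?thesis using FH[OF that] 2 finB by (simp add: card_Diff_subset)
      qed
      have disj: "(S - B) \<inter> (S' - B) = {}" if S: "S \<in> F" "S' \<in> F" "S \<noteq> S'" for S S'
      proof (rule ccontr)
        assume "(S - B) \<inter> (S' - B) \<noteq> {}"
        moreover obtain x where "S - B = {x}" using one[OF S(1)] by (rule card_1_singletonE)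
        moreover obtain y where "S' - B = {y}" using one[OF S(2)] by (rule card_1_singletonE)
        ultimately have "S - B = S' - B" by auto
        then show False using B[OF S(1)] B[OF S(2)] S(3) by blast
      qed
      show ?thesis
      proof (rule solvable_binary[where B = B, OF finF cF _ disj])
        fix S assume "S \<in> F"
        with one[of S] FH[of S] show "S \<subseteq> {1..t} \<and> S - B \<noteq> {}"
          by (metis card.empty zero_neq_one)
      qed
    next
      case 3
      have light: "S \<in> light" if "S \<in> F" for S
      proof -
        have "\<not> p \<subseteq> S" if "p \<in> heavy H (K * 2)" for p
        proof
          assume "p \<subseteq> S"
          with that U(4) B[OF \<open>S \<in> F\<close>] have "p \<subseteq> B" by blast
          then have "card p \<le> card B" using finB by (intro card_mono) auto
          with that 3 show False by (auto simp: heavy_def)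
        qed
        with FH[OF that] show ?thesis by (auto simp: light_def)
      qed
      have disj: "S \<inter> S' = {}" if S: "S \<in> F" "S' \<in> F" "S \<noteq> S'" for S S'
      proof (rule ccontr)
        assume meet: "S \<inter> S' \<noteq> {}"
        \<comment> \<open>Both edges show the same colours. A vertex \<open>v\<close> of
          \<open>S'\<close> with the colour of \<open>u\<close> conflicts with \<open>u\<close>
          because the two light edges meet, so the colouring forces \<open>u = v\<close>.\<close>
        have "S \<subseteq> S'"
        proof
          fix u assume u: "u \<in> S"
          with light[OF S(1)] have ul: "u \<in> \<Union>light" "col u \<le> ncol" using col(1)[of u u] by auto
          with u have "{v \<in> \<Union>light. col v = col u} \<inter> S \<noteq> {}" by auto
          with outcome(2)[of S S' "col u"] ul S have "{v \<in> \<Union>light. col v = col u} \<inter> S' \<noteq> {}"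
            by (auto simp: F_def)
          then obtain v where v: "v \<in> \<Union>light" "col v = col u" "v \<in> S'" by auto
          have "conflict u v"
            unfolding conflict_def using light[OF S(1)] light[OF S(2)] u v meet by blast
          with col(2)[OF ul(1) v(1)] v(2) have "u = v" by metis
          with v show "u \<in> S'" by simp
        qed
        with FH[OF S(1)] FH[OF S(2)] S(3) show False using card_subset_eq[of S' S] by auto
      qed
      have "card F \<le> M"
        using FH(1) disj by (intro matching) (auto simp: pairwise_def disjnt_def)
      then have cF: "card F \<le> 2 ^ n" using assms by simp
      show ?thesis
      proof (rule solvable_binary[where B = "{}", OF finF cF])
        fix S assume "S \<in> F"
        with FH[of S] show "S \<subseteq> {1..t} \<and> S - {} \<noteq> {}" by auto
      qed (use disj in simp)
    qed
    then show ?thesis unfolding F_def .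
  qed
  then have "solvable t (Suc (Suc 0)) (length Ts + n) H"
    using sub by (intro solvable_split)
  then show ?thesis
    unfolding numeral_2_eq_2 by (rule solvable_mono) (use len in linarith)
qed

end

section \<open>Counting labellings without large matchings\<close>

definition matches :: "(nat \<Rightarrow> 'b) \<Rightarrow> 'b list set \<Rightarrow> nat set \<Rightarrow> bool" where
  "matches f R e \<longleftrightarrow> map f (sorted_list_of_set e) \<in> R"

definition has_matching :: "nat set \<Rightarrow> nat \<Rightarrow> nat \<Rightarrow> 'b list set \<Rightarrow> (nat \<Rightarrow> 'b) \<Rightarrow> bool" where
  "has_matching A m k R f \<longleftrightarrow>
     (\<exists>F. F \<subseteq> {e. e \<subseteq> A \<and> card e = m} \<and> card F = k \<and> pairwise disjnt F \<and> (\<forall>e\<in>F. matches f R e))"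

text \<open>Labels on disjoint edges are independent, so all of \<open>F\<close> matches for a
  fraction of at most \<open>(card R / card W ^ m) ^ card F\<close> of the labellings, here
  cross-multiplied to stay in the naturals. The induction splits \<open>f\<close> into its labels on
  \<open>e\<close> and its restriction to \<open>A - e\<close>.\<close>

lemma card_matching_functions:
  fixes R :: "'b list set"
  assumes "finite F" "finite A" "finite W" "finite R"
    and "\<And>e. e \<in> F \<Longrightarrow> e \<subseteq> A \<and> card e = m" "pairwise disjnt F"
  shows "card {f \<in> A \<rightarrow>\<^sub>E W. \<forall>e\<in>F. matches f R e} * card W ^ (m * card F)
           \<le> card R ^ card F * card W ^ card A"
  using assms(1,2,5,6)
proof (induction F arbitrary: A rule: finite_induct)
  case empty
  have "{f \<in> A \<rightarrow>\<^sub>E W. \<forall>e\<in>{}. matches f R e} = A \<rightarrow>\<^sub>E W" by auto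
  then show ?case using empty by (simp add: card_PiE)
next
  case (insert e F)
  let ?G = "\<lambda>A F. {f \<in> A \<rightarrow>\<^sub>E W. \<forall>e\<in>F. matches f R e}"
  have e: "e \<subseteq> A" "card e = m" "finite e"
    using insert.prems by (auto intro: finite_subset)
  have F: "e' \<subseteq> A - e \<and> card e' = m" if "e' \<in> F" for e'
    using insert.prems that insert.hyps by (auto simp: pairwise_insert disjnt_def)
  have fin: "finite (?G A F)" if "finite A" for A F
    by (rule finite_subset[of _ "A \<rightarrow>\<^sub>E W"]) (use that assms(3) in \<open>auto intro: finite_PiE\<close>)
  have "inj_on (\<lambda>f. (map f (sorted_list_of_set e), restrict f (A - e))) (?G A (insert e F))"
  proof (rule inj_onI)
    fix f g assume f: "f \<in> ?G A (insert e F)" and g: "g \<in> ?G A (insert e F)"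
      and eq: "(map f (sorted_list_of_set e), restrict f (A - e)) =
               (map g (sorted_list_of_set e), restrict g (A - e))"
    show "f = g"
    proof
      fix x
      consider "x \<in> e" | "x \<in> A - e" | "x \<notin> A" by blast
      then show "f x = g x"
      proof cases
        case 1
        with eq e(3) show ?thesis by simp
      next
        case 2
        with eq have "restrict f (A - e) x = restrict g (A - e) x" by simp
        with 2 show ?thesis by simp
      next
        case 3
        with f g show ?thesis by (auto simp: PiE_def extensional_def)
      qed
    qed
  qed
  moreover have "(\<lambda>f. (map f (sorted_list_of_set e), restrict f (A - e))) ` ?G A (insert e F)
      \<subseteq> R \<times> ?G (A - e) F"
  proof (rule image_subsetI)
    fix f assume f: "f \<in> ?G A (insert e F)"
    have "matches (restrict f (A - e)) R e'" if "e' \<in> F" for e'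
    proof -
      have "finite e'" "e' \<subseteq> A - e" using F[OF that] insert.prems(1) by (auto intro: finite_subset)
      then have "map (restrict f (A - e)) (sorted_list_of_set e') = map f (sorted_list_of_set e')"
        by (intro map_cong) auto
      with f that show ?thesis by (simp only: matches_def) simp
    qed
    with f show "(map f (sorted_list_of_set e), restrict f (A - e)) \<in> R \<times> ?G (A - e) F"
      by (auto simp: matches_def)
  qed
  ultimately have "card (?G A (insert e F)) \<le> card (R \<times> ?G (A - e) F)"
    using assms(4) insert.prems(1) by (intro card_inj_on_le finite_cartesian_product fin) auto
  then have 1: "card (?G A (insert e F)) \<le> card R * card (?G (A - e) F)"
    by (simp add: card_cartesian_product)
  have cA: "card A = m + card (A - e)"
    using e insert.prems(1) by (metis card_Diff_subset card_mono le_add_diff_inverse)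
  have "card (?G A (insert e F)) * card W ^ (m * card (insert e F))
      \<le> card R * card (?G (A - e) F) * card W ^ (m * card (insert e F))"
    using 1 by (rule mult_right_mono) simp
  also have "\<dots> = card R * card W ^ m * (card (?G (A - e) F) * card W ^ (m * card F))"
    using insert.hyps by (simp add: power_add algebra_simps)
  also have "\<dots> \<le> card R * card W ^ m * (card R ^ card F * card W ^ card (A - e))"
    using insert.IH[of "A - e"] insert.prems F by (intro mult_left_mono) (auto simp: pairwise_insert)
  also have "\<dots> = card R ^ card (insert e F) * card W ^ card A"
    unfolding cA using insert.hyps by (simp add: power_add algebra_simps)
  finally show ?case .
qed

lemma pow_fact_le_exp: "(x::real) \<ge> 0 \<Longrightarrow> x ^ k / fact k \<le> exp x"
proof -
  assume x: "x \<ge> 0"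
  have "(\<Sum>n\<in>{k}. inverse (fact n) *\<^sub>R x ^ n) \<le> exp x"
    unfolding exp_def using x by (intro sum_le_suminf summable_exp_generic) auto
  then show ?thesis by (simp add: divide_inverse mult.commute)
qed

text \<open>There are at most \<open>(card A ^ m) ^ k / fact k\<close> families of \<open>k\<close>
  disjoint \<open>m\<close>-sets; a union bound over them applies
  \<open>card_matching_functions\<close>. The base of the power bounds the expected number of
  matching \<open>m\<close>-sets.\<close>

lemma card_has_matching:
  fixes R :: "'b list set"
  assumes "finite A" "finite W" "W \<noteq> {}" "finite R" "m > 0"
  shows "real (card {f \<in> A \<rightarrow>\<^sub>E W. has_matching A m k R f})
      \<le> (real (card A ^ m * card R) / real (card W) ^ m) ^ k / fact k * real (card W) ^ card A"
proof -
  define E where "E = {e. e \<subseteq> A \<and> card e = m}"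
  define Fs where "Fs = {F. F \<subseteq> E \<and> card F = k \<and> pairwise disjnt F}"
  let ?G = "\<lambda>F. {f \<in> A \<rightarrow>\<^sub>E W. \<forall>e\<in>F. matches f R e}"
  have "card E = card A choose m"
    unfolding E_def by (rule n_subsets[OF assms(1)])
  then have E: "finite E" "card E \<le> card A ^ m"
    using assms(1) binomial_le_pow[of m "card A"]
    by (simp add: E_def, cases "m \<le> card A") (simp_all add: binomial_eq_0)
  have Fs: "finite Fs" using E(1) unfolding Fs_def by simp
  have "card Fs \<le> card {F. F \<subseteq> E \<and> card F = k}"
    unfolding Fs_def using E(1) by (intro card_mono) auto
  also have "\<dots> = card E choose k" using n_subsets[OF E(1)] .
  finally have "real (card Fs) * fact k \<le> real (card E choose k) * fact k" by simp
  also have "\<dots> \<le> real (card E ^ k)"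
    using binomial_fact_pow[of "card E" k] by (metis of_nat_fact of_nat_le_iff of_nat_mult)
  also have "\<dots> \<le> real (card A ^ m) ^ k" using E(2) by (simp add: power_mono flip: of_nat_power)
  finally have cFs: "real (card Fs) \<le> real (card A ^ m) ^ k / fact k"
    by (simp add: field_simps)
  have Wpos: "real (card W) > 0" using assms by (simp add: card_gt_0_iff)
  have finG: "finite (?G F)" for F
    by (rule finite_subset[of _ "A \<rightarrow>\<^sub>E W"]) (use assms in \<open>auto intro: finite_PiE\<close>)
  have G: "real (card (?G F)) \<le> (real (card R) / real (card W) ^ m) ^ k * real (card W) ^ card A"
    if "F \<in> Fs" for F
  proof -
    from that E(1) have F: "finite F" "F \<subseteq> E" "card F = k" "pairwise disjnt F"
      by (auto simp: Fs_def intro: finite_subset)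
    have "card (?G F) * card W ^ (m * card F) \<le> card R ^ card F * card W ^ card A"
      using F assms by (intro card_matching_functions) (auto simp: E_def)
    then have "real (card (?G F)) * real (card W) ^ (m * k) \<le> real (card R) ^ k * real (card W) ^ card A"
      unfolding F(3) by (simp only: flip: of_nat_mult of_nat_power of_nat_le_iff[where 'a = real])
    then have "real (card (?G F)) \<le> real (card R) ^ k * real (card W) ^ card A / real (card W) ^ (m * k)"
      using Wpos by (subst pos_le_divide_eq) simp_all
    then show ?thesis by (simp add: power_divide power_mult)
  qed
  have "{f \<in> A \<rightarrow>\<^sub>E W. has_matching A m k R f} \<subseteq> (\<Union>F\<in>Fs. ?G F)"
    unfolding has_matching_def Fs_def E_def by blast
  then have "card {f \<in> A \<rightarrow>\<^sub>E W. has_matching A m k R f} \<le> card (\<Union>F\<in>Fs. ?G F)"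
    using Fs finG by (intro card_mono finite_UN_I)
  also have "\<dots> \<le> (\<Sum>F\<in>Fs. card (?G F))" by (rule card_UN_le[OF Fs])
  finally have "real (card {f \<in> A \<rightarrow>\<^sub>E W. has_matching A m k R f}) \<le> (\<Sum>F\<in>Fs. real (card (?G F)))"
    by (simp flip: of_nat_sum)
  also have "\<dots> \<le> real (card Fs) * ((real (card R) / real (card W) ^ m) ^ k * real (card W) ^ card A)"
    using G by (rule sum_bounded_above)
  also have "\<dots> \<le> real (card A ^ m) ^ k / fact k * ((real (card R) / real (card W) ^ m) ^ k * real (card W) ^ card A)"
    using cFs by (rule mult_right_mono) simp
  also have "\<dots> = (real (card A ^ m * card R) / real (card W) ^ m) ^ k / fact k * real (card W) ^ card A"
    by (simp add: power_mult_distrib power_divide mult_ac)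
  finally show ?thesis .
qed

lemma card_has_matching_family:
  fixes R :: "'j \<Rightarrow> 'b list set"
  assumes "finite A" "finite W" "W \<noteq> {}" "finite J" "\<And>j. j \<in> J \<Longrightarrow> finite (R j)" "m > 0"
    and mu: "\<And>j. j \<in> J \<Longrightarrow> real (card A) ^ m * real (card (R j)) \<le> \<mu> * real (card W) ^ m"
    and small: "real (card J) * (\<mu> ^ k / fact k) \<le> \<epsilon>"
  shows "real (card {f \<in> A \<rightarrow>\<^sub>E W. \<exists>j\<in>J. has_matching A m k (R j) f}) \<le> \<epsilon> * real (card W) ^ card A"
proof -
  let ?B = "\<lambda>j. {f \<in> A \<rightarrow>\<^sub>E W. has_matching A m k (R j) f}"
  have Wpos: "real (card W) > 0" using assms by (simp add: card_gt_0_iff)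
  have B: "real (card (?B j)) \<le> \<mu> ^ k / fact k * real (card W) ^ card A" if "j \<in> J" for j
  proof -
    have "real (card A ^ m * card (R j)) / real (card W) ^ m \<le> \<mu>"
      using mu[OF that] Wpos by (simp add: field_simps)
    then have "(real (card A ^ m * card (R j)) / real (card W) ^ m) ^ k \<le> \<mu> ^ k"
      by (intro power_mono) auto
    then have "(real (card A ^ m * card (R j)) / real (card W) ^ m) ^ k / fact k * real (card W) ^ card A
        \<le> \<mu> ^ k / fact k * real (card W) ^ card A"
      by (intro mult_right_mono divide_right_mono) auto
    with card_has_matching[of A W "R j" m k] assms that show ?thesis by fastforce
  qed
  have "{f \<in> A \<rightarrow>\<^sub>E W. \<exists>j\<in>J. has_matching A m k (R j) f} = (\<Union>j\<in>J. ?B j)" by auto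
  then have "real (card {f \<in> A \<rightarrow>\<^sub>E W. \<exists>j\<in>J. has_matching A m k (R j) f}) \<le> (\<Sum>j\<in>J. real (card (?B j)))"
    using card_UN_le[OF assms(4), of ?B] by (simp flip: of_nat_sum)
  also have "\<dots> \<le> real (card J) * (\<mu> ^ k / fact k * real (card W) ^ card A)"
    using B by (rule sum_bounded_above)
  also have "\<dots> = real (card J) * (\<mu> ^ k / fact k) * real (card W) ^ card A" by simp
  also have "\<dots> \<le> \<epsilon> * real (card W) ^ card A"
    using small by (rule mult_right_mono) simp
  finally show ?thesis .
qed

section \<open>Generating function of covering lists\<close>

definition covers :: "nat set \<Rightarrow> nat \<Rightarrow> nat set \<Rightarrow> nat set \<Rightarrow> nat set list set" where
  "covers I m X r = {l. length l = m \<and> set l \<subseteq> Pow I \<and> X \<union> \<Union>(set l) = r}"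

lemma finite_covers: "finite I \<Longrightarrow> finite (covers I m X r)"
  by (rule finite_subset[OF _ finite_lists_length_eq[of "Pow I" m]]) (auto simp: covers_def)

text \<open>The contribution of the coordinate \<open>i\<close> to the generating function of \<open>covers\<close>, in which a list
  of sets is weighted by \<open>z\<close> to its total size.\<close>

definition covers_factor :: "real \<Rightarrow> nat \<Rightarrow> nat set \<Rightarrow> nat set \<Rightarrow> nat \<Rightarrow> real" where
  "covers_factor z m X r i =
     (if i \<in> r then (1 + z) ^ m - (if i \<in> X then 0 else 1) else if i \<in> X then 0 else 1)"

lemma covers_Suc:
  "covers I (Suc m) X r = (\<Union>x\<in>Pow I. (#) x ` covers I m (X \<union> x) r)"
proof (intro equalityI subsetI)
  fix l assume "l \<in> covers I (Suc m) X r"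
  then obtain x l' where "l = x # l'" "x \<subseteq> I" "l' \<in> covers I m (X \<union> x) r"
    unfolding covers_def by (cases l) (simp_all add: Un_assoc)
  then show "l \<in> (\<Union>x\<in>Pow I. (#) x ` covers I m (X \<union> x) r)" by blast
next
  fix l assume "l \<in> (\<Union>x\<in>Pow I. (#) x ` covers I m (X \<union> x) r)"
  then show "l \<in> covers I (Suc m) X r" by (auto simp: covers_def subset_iff)
qed

text \<open>The sum factorises because each index decides on its own which of the \<open>m\<close>
  sets contain it. All choices together weigh \<open>(1 + z) ^ m\<close>; the empty choice is
  forbidden on \<open>r - X\<close> and is the only one outside \<open>r\<close>.\<close>

lemma sum_covers:
  assumes "finite I" "X \<subseteq> I" "r \<subseteq> I"
  shows "(\<Sum>l\<in>covers I m X r. z ^ sum_list (map card l)) = (\<Prod>i\<in>I. covers_factor z m X r i)"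
  using assms(2)
proof (induction m arbitrary: X)
  case 0
  show ?case
  proof (cases "X = r")
    case True
    then have "covers I 0 X r = {[]}" by (auto simp: covers_def)
    moreover have "(\<Prod>i\<in>I. covers_factor z 0 X r i) = 1"
      using True by (intro prod.neutral) (auto simp: covers_factor_def)
    ultimately show ?thesis by simp
  next
    case False
    then obtain i where "i \<in> I" "i \<in> X \<longleftrightarrow> i \<notin> r" using assms(3) 0 by auto
    then have "(\<Prod>i\<in>I. covers_factor z 0 X r i) = 0"
      using assms(1) by (intro prod_zero bexI[of _ i]) (auto simp: covers_factor_def)
    moreover have "covers I 0 X r = {}" using False by (auto simp: covers_def)
    ultimately show ?thesis by simp
  qed
next
  case (Suc m)
  have "(\<Sum>l\<in>covers I (Suc m) X r. z ^ sum_list (map card l)) =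
      (\<Sum>x\<in>Pow I. \<Sum>l\<in>(#) x ` covers I m (X \<union> x) r. z ^ sum_list (map card l))"
    unfolding covers_Suc using assms(1) finite_covers[OF assms(1)]
    by (intro sum.UNION_disjoint) auto
  also have "\<dots> = (\<Sum>x\<in>Pow I. z ^ card x * (\<Sum>l\<in>covers I m (X \<union> x) r. z ^ sum_list (map card l)))"
    by (subst sum.reindex) (auto simp: sum_distrib_left power_add)
  also have "\<dots> = (\<Sum>x\<in>Pow I. (\<Prod>i\<in>x. z * covers_factor z m (insert i X) r i) *
                                (\<Prod>i\<in>I - x. covers_factor z m X r i))"
  proof (rule sum.cong)
    fix x assume x: "x \<in> Pow I"
    then have fx: "finite x" using assms(1) finite_subset by auto
    have "(\<Prod>i\<in>I. covers_factor z m (X \<union> x) r i) =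
        (\<Prod>i\<in>x. covers_factor z m (X \<union> x) r i) * (\<Prod>i\<in>I - x. covers_factor z m (X \<union> x) r i)"
      using x assms(1) by (subst prod.subset_diff[of x I]) (auto simp: mult.commute)
    also have "(\<Prod>i\<in>x. covers_factor z m (X \<union> x) r i) = (\<Prod>i\<in>x. covers_factor z m (insert i X) r i)"
      by (intro prod.cong) (auto simp: covers_factor_def)
    also have "(\<Prod>i\<in>I - x. covers_factor z m (X \<union> x) r i) = (\<Prod>i\<in>I - x. covers_factor z m X r i)"
      by (intro prod.cong) (auto simp: covers_factor_def)
    finally have "(\<Prod>i\<in>I. covers_factor z m (X \<union> x) r i) =
        (\<Prod>i\<in>x. covers_factor z m (insert i X) r i) * (\<Prod>i\<in>I - x. covers_factor z m X r i)" .
    then show "z ^ card x * (\<Sum>l\<in>covers I m (X \<union> x) r. z ^ sum_list (map card l)) =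
        (\<Prod>i\<in>x. z * covers_factor z m (insert i X) r i) * (\<Prod>i\<in>I - x. covers_factor z m X r i)"
      using x Suc.prems by (subst Suc.IH) (auto simp: prod.distrib)
  qed simp
  \<comment> \<open>Expanding this product of sums gives one term for each set \<open>x\<close> of
    indices put into the first member of the list.\<close>
  also have "\<dots> = (\<Prod>i\<in>I. z * covers_factor z m (insert i X) r i + covers_factor z m X r i)"
    using assms(1) by (rule prod_add[symmetric])
  also have "\<dots> = (\<Prod>i\<in>I. covers_factor z (Suc m) X r i)"
    by (intro prod.cong) (auto simp: covers_factor_def algebra_simps)
  finally show ?case .
qed

section \<open>Constant weight labels\<close>

text \<open>Consecutive terms of the expansion of \<open>(1 + z) ^ N\<close> have ratio
  \<open>(N - k) * z / (k + 1)\<close>, which is at least 1 exactly for \<open>k < w\<close>; hence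
  term \<open>w\<close> is the largest of \<open>N + 1\<close> terms.\<close>

lemma binomial_mode:
  fixes z :: real
  assumes "z > 0" and w: "w = nat \<lfloor>(real N + 1) * z / (1 + z)\<rfloor>"
  shows "(1 + z) ^ N \<le> (real N + 1) * (real (N choose w) * z ^ w)"
proof -
  define g where "g k = real (N choose k) * z ^ k" for k
  have step: "real (Suc k) * g (Suc k) = real (N - k) * z * g k" for k
  proof -
    have "Suc k * (N choose Suc k) = (N - k) * (N choose k)"
      using binomial_absorption[of k N] binomial_absorb_comp[of N k] by simp
    then have "real (Suc k) * real (N choose Suc k) = real (N - k) * real (N choose k)"
      by (metis of_nat_mult)
    then show ?thesis unfolding g_def by (simp add: mult_ac del: of_nat_Suc)
  qed
  have up: "g k \<le> g (Suc k)" if "k < w" for k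
  proof -
    have "real (Suc k) \<le> (real N + 1) * z / (1 + z)"
      using that w by linarith
    then have "real (Suc k) * (1 + z) \<le> (real N + 1) * z"
      using assms(1) by (simp add: field_simps)
    then have le: "real (Suc k) \<le> (real N - real k) * z" by (simp add: algebra_simps)
    then have "0 < (real N - real k) * z" using of_nat_0_less_iff[of "Suc k"] by linarith
    then have "k < N" using assms(1) by (simp add: zero_less_mult_iff)
    with le have "real (Suc k) * g k \<le> real (N - k) * z * g k"
      using assms(1) by (intro mult_right_mono) (auto simp: g_def of_nat_diff)
    then have "real (Suc k) * g k \<le> real (Suc k) * g (Suc k)" using step by simp
    then show ?thesis by (simp del: of_nat_Suc)
  qed
  have down: "g (Suc k) \<le> g k" if "w \<le> k" for k
  proof (cases "k < N")
    case True
    have "(real N + 1) * z / (1 + z) \<le> real (Suc k)"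
      using that w by linarith
    then have "(real N + 1) * z \<le> real (Suc k) * (1 + z)"
      using assms(1) by (simp add: field_simps)
    then have "(real N - real k) * z \<le> real (Suc k)" by (simp add: algebra_simps)
    then have "real (N - k) * z * g k \<le> real (Suc k) * g k"
      using assms(1) True by (intro mult_right_mono) (auto simp: g_def of_nat_diff)
    then have "real (Suc k) * g (Suc k) \<le> real (Suc k) * g k" using step by simp
    then show ?thesis by (simp del: of_nat_Suc)
  qed (use assms(1) in \<open>simp add: g_def binomial_eq_0\<close>)
  have max: "g k \<le> g w" for k
  proof (cases "k \<le> w")
    case True
    then show ?thesis by (induction rule: inc_induct) (use up order.trans in blast)+
  next
    case False
    then have "w \<le> k" by simp
    then show ?thesis by (induction rule: dec_induct) (use down order.trans in blast)+
  qed
  have "(1 + z) ^ N = (\<Sum>k\<le>N. g k)"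
    unfolding g_def by (subst add.commute, subst binomial_ring) (simp add: mult_ac)
  also have "\<dots> \<le> real (card {..N}) * g w" using max by (intro sum_bounded_above) auto
  finally show ?thesis by (simp add: g_def add.commute)
qed

lemma prod_covers_factor_le:
  assumes "finite I" "X \<subseteq> I" "r \<subseteq> I" "z > 0"
  shows "(\<Prod>i\<in>I. covers_factor z m X r i) \<le> ((1 + z) ^ m) ^ card X * ((1 + z) ^ m - 1) ^ card (r - X)"
proof -
  let ?a = "(1 + z) ^ m" and ?b = "(1 + z) ^ m - 1"
  have one: "1 \<le> ?a" using assms(4) by (intro one_le_power) simp
  have "(\<Prod>i\<in>I. covers_factor z m X r i) \<le> (\<Prod>i\<in>I. (if i \<in> X then ?a else 1) * (if i \<in> r - X then ?b else 1))"
    using one by (intro prod_mono) (auto simp: covers_factor_def)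
  also have "\<dots> = (\<Prod>i\<in>I. if i \<in> X then ?a else 1) * (\<Prod>i\<in>I. if i \<in> r - X then ?b else 1)"
    by (rule prod.distrib)
  also have "(\<Prod>i\<in>I. if i \<in> X then ?a else 1) = ?a ^ card X"
    using assms by (simp add: prod.If_cases Int_absorb1)
  also have "(\<Prod>i\<in>I. if i \<in> r - X then ?b else 1) = ?b ^ card (r - X)"
    using assms by (subst prod.If_cases) (auto simp: Int_absorb1 intro!: arg_cong[of _ _ "\<lambda>A. ?b ^ card A"])
  finally show ?thesis .
qed

definition words :: "nat \<Rightarrow> nat \<Rightarrow> nat set set" where
  "words N w = {x. x \<subseteq> {..<N} \<and> card x = w}"

lemma finite_words [simp]: "finite (words N w)"
  unfolding words_def by (rule finite_subset[of _ "Pow {..<N}"]) auto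

lemma card_words: "card (words N w) = N choose w"
  unfolding words_def using n_subsets[of "{..<N}" w] by simp

text \<open>Label lists possible for \<open>m\<close> unknown samples when stage one has revealed
  \<open>r\<close> and \<open>X\<close> is the union of the labels already fixed.\<close>

definition word_covers :: "nat \<Rightarrow> nat \<Rightarrow> nat \<Rightarrow> nat set \<Rightarrow> nat set \<Rightarrow> nat set list set" where
  "word_covers N w m X r = {l. length l = m \<and> set l \<subseteq> words N w \<and> X \<union> \<Union>(set l) = r}"

text \<open>Pairs of labels that nearly exhaust \<open>r\<close>. The threshold
  \<open>3 * w / 10\<close> separates pairs with few possible third samples from pairs that are
  themselves rare.\<close>

definition near_covers :: "nat \<Rightarrow> nat \<Rightarrow> nat set \<Rightarrow> nat set list set" where
  "near_covers N w r = {l. length l = 2 \<and> set l \<subseteq> words N w \<and> \<Union>(set l) \<subseteq> r \<and>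
     10 * card (r - \<Union>(set l)) \<le> 3 * w}"

lemma word_covers_subset: "word_covers N w m X r \<subseteq> covers {..<N} m X r"
  by (auto simp: word_covers_def covers_def words_def)

lemma finite_word_covers [simp]: "finite (word_covers N w m X r)"
  using word_covers_subset finite_covers[of "{..<N}"] by (rule finite_subset) simp

lemma finite_near_covers [simp]: "finite (near_covers N w r)"
  by (rule finite_subset[OF _ finite_lists_length_eq[of "words N w" 2]]) (auto simp: near_covers_def)

text \<open>All these lists have total size \<open>m * w\<close>, so each contributes
  \<open>z ^ (m * w)\<close> to the generating function. The weight \<open>z\<close> is free and is
  chosen in each application.\<close>

lemma card_word_covers_le:
  assumes "X \<subseteq> {..<N}" "r \<subseteq> {..<N}" "z > 0"
  shows "real (card (word_covers N w m X r)) * z ^ (m * w)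
           \<le> ((1 + z) ^ m) ^ card X * ((1 + z) ^ m - 1) ^ card (r - X)"
proof -
  have sum: "sum_list (map card l) = m * w" if "length l = m" "set l \<subseteq> words N w" for l
    using that by (induction l arbitrary: m) (auto simp: words_def)
  have "real (card (word_covers N w m X r)) * z ^ (m * w)
      = (\<Sum>l\<in>word_covers N w m X r. z ^ sum_list (map card l))"
    by (subst sum.cong[OF refl, of _ _ "\<lambda>_. z ^ (m * w)"]) (auto simp: word_covers_def sum)
  also have "\<dots> \<le> (\<Sum>l\<in>covers {..<N} m X r. z ^ sum_list (map card l))"
    using assms(3) finite_covers word_covers_subset by (intro sum_mono2) auto
  also have "\<dots> = (\<Prod>i\<in>{..<N}. covers_factor z m X r i)"
    using assms by (intro sum_covers) auto
  also have "\<dots> \<le> ((1 + z) ^ m) ^ card X * ((1 + z) ^ m - 1) ^ card (r - X)"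
    using assms by (intro prod_covers_factor_le) auto
  finally show ?thesis .
qed

text \<open>A second weight \<open>y ^ 10\<close> is charged for every index of \<open>r\<close>
  that the pair misses; at most \<open>3 * w / 10\<close> are missed, so each pair keeps at least
  \<open>y ^ (3 * w)\<close>. Summing over the union \<open>u\<close> of the pair gives a factor
  \<open>(1 + z)\<^sup>2 - 1 + y ^ 10\<close> per index of \<open>r\<close>.\<close>

lemma card_near_covers_le:
  assumes "r \<subseteq> {..<N}" "z > 0" "0 < y" "y \<le> 1" "(1 + z)\<^sup>2 - 1 + y ^ 10 \<le> 1"
  shows "real (card (near_covers N w r)) * (z ^ (2 * w) * y ^ (3 * w)) \<le> 1"
proof -
  let ?b = "(1 + z)\<^sup>2 - 1"
  have fr: "finite r" using assms(1) finite_subset by blast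
  have b: "0 \<le> ?b" using assms(2) by (simp add: power2_eq_square algebra_simps)
  define D where "D = {u. u \<subseteq> r \<and> 10 * card (r - u) \<le> 3 * w}"
  have fD: "finite D" using fr by (simp add: D_def)
  have "near_covers N w r \<subseteq> (\<Union>u\<in>D. word_covers N w 2 {} u)"
    by (auto simp: near_covers_def word_covers_def D_def)
  then have "card (near_covers N w r) \<le> card (\<Union>u\<in>D. word_covers N w 2 {} u)"
    using fD by (intro card_mono) auto
  also have "\<dots> \<le> (\<Sum>u\<in>D. card (word_covers N w 2 {} u))" by (rule card_UN_le[OF fD])
  finally have "real (card (near_covers N w r)) \<le> (\<Sum>u\<in>D. real (card (word_covers N w 2 {} u)))"
    by (simp flip: of_nat_sum)
  then have "real (card (near_covers N w r)) * (z ^ (2 * w) * y ^ (3 * w))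
      \<le> (\<Sum>u\<in>D. real (card (word_covers N w 2 {} u))) * (z ^ (2 * w) * y ^ (3 * w))"
    using assms by (intro mult_right_mono) auto
  also have "\<dots> = (\<Sum>u\<in>D. (real (card (word_covers N w 2 {} u)) * z ^ (2 * w)) * y ^ (3 * w))"
    by (simp only: sum_distrib_right mult.assoc)
  also have "\<dots> \<le> (\<Sum>u\<in>D. ?b ^ card u * (y ^ 10) ^ card (r - u))"
  proof (intro sum_mono mult_mono)
    fix u assume u: "u \<in> D"
    then show "real (card (word_covers N w 2 {} u)) * z ^ (2 * w) \<le> ?b ^ card u"
      using card_word_covers_le[of "{}" N u z w 2] assms by (auto simp: D_def)
    have "y ^ (3 * w) \<le> y ^ (10 * card (r - u))"
      using u assms by (intro power_decreasing) (auto simp: D_def)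
    then show "y ^ (3 * w) \<le> (y ^ 10) ^ card (r - u)" by (simp add: power_mult)
  qed (use b assms in auto)
  also have "\<dots> \<le> (\<Sum>u\<in>Pow r. ?b ^ card u * (y ^ 10) ^ card (r - u))"
    using fr b assms by (intro sum_mono2) (auto simp: D_def)
  also have "\<dots> = (\<Sum>u\<in>Pow r. (\<Prod>i\<in>u. ?b) * (\<Prod>i\<in>r - u. y ^ 10))" by simp
  also have "\<dots> = (\<Prod>i\<in>r. ?b + y ^ 10)" by (rule prod_add[OF fr, symmetric])
  also have "\<dots> \<le> 1" using b assms by (intro prod_le_1) auto
  finally show ?thesis .
qed

section \<open>From good labels to an algorithm\<close>

lemma matches_word_covers:
  assumes "f \<in> A \<rightarrow>\<^sub>E words N w" "e \<subseteq> A" "finite e" "card e = m" "X \<union> \<Union>(f ` e) = r"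
  shows "matches f (word_covers N w m X r) e"
proof -
  have "f ` e \<subseteq> words N w" using assms(1,2) by auto
  with assms(3-5) show ?thesis by (simp add: matches_def word_covers_def)
qed

lemma card_le_of_no_matching:
  assumes "\<not> has_matching A m k R f" "\<And>e. e \<in> F \<Longrightarrow> e \<subseteq> A \<and> card e = m" "pairwise disjnt F"
    "\<And>e. e \<in> F \<Longrightarrow> matches f R e"
  shows "card F \<le> k"
proof (rule ccontr)
  assume "\<not> card F \<le> k"
  then obtain G where "G \<subseteq> F" "card G = k"
    using obtain_subset_with_card_n[of k F] by (metis nat_le_linear)
  then have "has_matching A m k R f"
    unfolding has_matching_def using assms(2-4)
    by (intro exI[of _ G]) (auto intro: pairwise_subset)
  with assms(1) show False by simp
qed

text \<open>The assumptions mirror \<open>hypergraph3\<close>: \<open>no3\<close> bounds matchings,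
  \<open>no2\<close> links, \<open>no1\<close> pair degrees. Heavy pairs need two: by
  \<open>no1_far\<close> a heavy pair leaves little of \<open>r\<close> uncovered, and by
  \<open>no2_near\<close> few such pairs are disjoint.\<close>

locale good_labels =
  fixes t N w K M :: nat and f :: "nat \<Rightarrow> nat set"
  assumes f: "f \<in> {1..t} \<rightarrow>\<^sub>E words N w"
    and no3: "\<And>r. r \<subseteq> {..<N} \<Longrightarrow> \<not> has_matching {1..t} 3 M (word_covers N w 3 {} r) f"
    and no2: "\<And>X r. X \<in> words N w \<Longrightarrow> r \<subseteq> {..<N} \<Longrightarrow>
      \<not> has_matching {1..t} 2 K (word_covers N w 2 X r) f"
    and no1: "\<And>X r. X \<subseteq> {..<N} \<Longrightarrow> card X \<le> 2 * w \<Longrightarrow> r \<subseteq> {..<N} \<Longrightarrow>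
      \<not> has_matching {1..t} 1 M (word_covers N w 1 X r) f"
    and no1_far: "\<And>X r. X \<subseteq> {..<N} \<Longrightarrow> card X \<le> 2 * w \<Longrightarrow> r \<subseteq> {..<N} \<Longrightarrow>
      3 * w < 10 * card (r - X) \<Longrightarrow> \<not> has_matching {1..t} 1 K (word_covers N w 1 X r) f"
    and no2_near: "\<And>r. r \<subseteq> {..<N} \<Longrightarrow> \<not> has_matching {1..t} 2 K (near_covers N w r) f"
begin

definition consistent :: "nat set \<Rightarrow> nat set set" where
  "consistent r = {S \<in> gt_cands t 3. \<Union>(f ` S) = r}"

lemma consistentD:
  assumes "S \<in> consistent r"
  shows "S \<subseteq> {1..t}" "card S = 3" "finite S" "\<Union>(f ` S) = r"
  using assms by (auto simp: consistent_def gt_cands_def intro: finite_subset)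

lemma f_words: "v \<in> {1..t} \<Longrightarrow> f v \<in> words N w"
  using f by auto

lemma r_subset: "S \<in> consistent r \<Longrightarrow> r \<subseteq> {..<N}"
proof -
  assume "S \<in> consistent r"
  note S = consistentD[OF this]
  have "f v \<subseteq> {..<N}" if "v \<in> S" for v
    using f_words[OF subsetD[OF S(1) that]] by (simp add: words_def)
  with S(4) show ?thesis by blast
qed

lemma pair_union:
  assumes "card p = 2" "p \<subseteq> {1..t}"
  shows "\<Union>(f ` p) \<subseteq> {..<N}" "card (\<Union>(f ` p)) \<le> 2 * w"
proof -
  show "\<Union>(f ` p) \<subseteq> {..<N}" using assms f_words by (fastforce simp: words_def)
  have "card (\<Union>v\<in>p. f v) \<le> (\<Sum>v\<in>p. card (f v))"
    using assms(1) by (intro card_UN_le) (auto intro: card_ge_0_finite)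
  also have "\<dots> = (\<Sum>v\<in>p. w)"
    using assms(2) f_words by (intro sum.cong) (auto simp: words_def)
  finally show "card (\<Union>(f ` p)) \<le> 2 * w" using assms(1) by simp
qed

text \<open>Removing \<open>p\<close> leaves distinct singletons, which are disjoint; the degree of
  \<open>p\<close> is thus a matching number with \<open>m = 1\<close>.\<close>

lemma edge_deg_le:
  assumes p: "card p = 2" "p \<subseteq> {1..t}"
    and no: "\<not> has_matching {1..t} 1 k (word_covers N w 1 (\<Union>(f ` p)) r) f"
  shows "edge_deg (consistent r) p \<le> k"
proof -
  define F where "F = (\<lambda>e. e - p) ` {e \<in> consistent r. p \<subseteq> e}"
  have "inj_on (\<lambda>e. e - p) {e \<in> consistent r. p \<subseteq> e}" by (rule inj_onI) blast
  then have "edge_deg (consistent r) p = card F"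
    unfolding F_def edge_deg_def by (rule card_image[symmetric])
  also have "\<dots> \<le> k"
  proof (rule card_le_of_no_matching[OF no])
    have 1: "e \<subseteq> {1..t} \<and> card e = 1 \<and> \<Union>(f ` p) \<union> \<Union>(f ` e) = r \<and> finite e"
      if eF: "e \<in> F" for e
    proof -
      obtain e' where e': "e = e' - p" "e' \<in> consistent r" "p \<subseteq> e'"
        using eF by (auto simp: F_def)
      have "finite p" using p by (auto intro: card_ge_0_finite)
      then have "card e = 1" using e' p consistentD[OF e'(2)] by (simp add: card_Diff_subset)
      moreover have "\<Union>(f ` p) \<union> \<Union>(f ` e) = \<Union>(f ` e')" using e' by auto
      ultimately show ?thesis using e' consistentD[OF e'(2)] by auto
    qed
    show "e \<subseteq> {1..t} \<and> card e = 1" if "e \<in> F" for e using 1[OF that] by simp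
    show "matches f (word_covers N w 1 (\<Union>(f ` p)) r) e" if "e \<in> F" for e
      using 1[OF that] by (intro matches_word_covers[OF f]) auto
    show "pairwise disjnt F"
    proof (rule pairwiseI)
      fix a b assume "a \<in> F" "b \<in> F" "a \<noteq> b"
      moreover from 1[OF this(1)] obtain x where "a = {x}" by (metis card_1_singletonE)
      moreover from 1[OF \<open>b \<in> F\<close>] obtain y where "b = {y}" by (metis card_1_singletonE)
      ultimately show "disjnt a b" by (simp add: disjnt_def)
    qed
  qed
  finally show ?thesis .
qed

lemma hypergraph: "hypergraph3 t (consistent r) K M"
proof
  show "e \<subseteq> {1..t} \<and> card e = 3" if "e \<in> consistent r" for e
    using consistentD[OF that] by simp
next
  fix F assume F: "F \<subseteq> consistent r" "pairwise disjnt F"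
  show "card F \<le> M"
  proof (cases "F = {}")
    case False
    then have r: "r \<subseteq> {..<N}" using F r_subset by auto
    have e: "e \<in> consistent r" if "e \<in> F" for e using F that by auto
    show ?thesis
      using consistentD[OF e]
      by (intro card_le_of_no_matching[OF no3[OF r] _ F(2)] matches_word_covers[OF f]) auto
  qed simp
next
  fix v F assume F: "F \<subseteq> link (consistent r) v" "pairwise disjnt F"
  show "card F \<le> K"
  proof (cases "F = {}")
    case False
    have 1: "v \<in> {1..t} \<and> r \<subseteq> {..<N} \<and> e \<subseteq> {1..t} \<and> card e = 2 \<and> f v \<union> \<Union>(f ` e) = r \<and> finite e"
      if e: "e \<in> F" for e
    proof -
      obtain e' where e': "e = e' - {v}" "e' \<in> consistent r" "v \<in> e'"
        using F(1) e by (auto simp: link_def)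
      have "f v \<union> \<Union>(f ` e) = \<Union>(f ` e')" using e' by auto
      then show ?thesis using e' consistentD[OF e'(2)] r_subset[OF e'(2)]
        by (auto simp: card_Diff_singleton)
    qed
    from False obtain e where "e \<in> F" by auto
    from 1[OF this] have v: "f v \<in> words N w" "r \<subseteq> {..<N}" using f_words by auto
    show ?thesis
      using 1 by (intro card_le_of_no_matching[OF no2[OF v] _ F(2)] matches_word_covers[OF f]) auto
  qed simp
next
  fix p :: "nat set" assume p: "card p = 2"
  show "edge_deg (consistent r) p \<le> M"
  proof (cases "{e \<in> consistent r. p \<subseteq> e} = {}")
    case True
    then show ?thesis unfolding edge_deg_def by (simp only: card.empty)
  next
    case False
    then obtain e where e: "e \<in> consistent r" "p \<subseteq> e" by auto
    then have pt: "p \<subseteq> {1..t}" using consistentD[of e r] by auto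
    show ?thesis
      using pair_union[OF p pt] r_subset[OF e(1)] by (intro edge_deg_le p pt no1)
  qed
next
  fix F assume F: "F \<subseteq> heavy (consistent r) (K * 2)" "pairwise disjnt F"
  show "card F \<le> K"
  proof (cases "F = {}")
    case False
    have 1: "p \<subseteq> {1..t} \<and> card p = 2 \<and> r \<subseteq> {..<N} \<and> \<Union>(f ` p) \<subseteq> r \<and>
       10 * card (r - \<Union>(f ` p)) \<le> 3 * w" if "p \<in> F" for p
    proof -
      have p: "card p = 2" "edge_deg (consistent r) p > K * 2"
        using F(1) that by (auto simp: heavy_def)
      then have "{e \<in> consistent r. p \<subseteq> e} \<noteq> {}"
        unfolding edge_deg_def by (metis card.empty not_less_zero)
      then obtain e where e: "e \<in> consistent r" "p \<subseteq> e" by auto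
      then have pt: "p \<subseteq> {1..t}" and X: "\<Union>(f ` p) \<subseteq> r" using consistentD[of e r] by auto
      note r = r_subset[OF e(1)]
      have "\<not> 3 * w < 10 * card (r - \<Union>(f ` p))"
      proof
        assume "3 * w < 10 * card (r - \<Union>(f ` p))"
        then have "edge_deg (consistent r) p \<le> K"
          using pair_union[OF p(1) pt] r by (intro edge_deg_le p pt no1_far)
        with p show False by simp
      qed
      with p pt X r show ?thesis by auto
    qed
    from False obtain p where "p \<in> F" by auto
    with 1 have r: "r \<subseteq> {..<N}" by blast
    show ?thesis
    proof (rule card_le_of_no_matching[OF no2_near[OF r] _ F(2)])
      fix p assume "p \<in> F"
      from 1[OF this] show "p \<subseteq> {1..t} \<and> card p = 2" by simp
      have "finite p" using 1[OF \<open>p \<in> F\<close>] by (auto intro: card_ge_0_finite)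
      with 1[OF \<open>p \<in> F\<close>] f_words show "matches f (near_covers N w r) p"
        by (auto simp: matches_def near_covers_def)
    qed
  qed simp
qed

lemma solvable_cands:
  assumes "M \<le> 2 ^ n"
  shows "solvable t 5 (N + (K * 2 + K * 2 * (K * 2) +
           (K * 2 * (K * 2) * 3) * (K * 2 * (K * 2) * 3) + 1 + n)) (gt_cands t 3)"
proof -
  define k where "k = K * 2 + K * 2 * (K * 2) + (K * 2 * (K * 2) * 3) * (K * 2 * (K * 2) * 3) + 1 + n"
  have H: "solvable t 2 k (consistent r)" for r
  proof -
    interpret hypergraph3 t "consistent r" K M by (rule hypergraph)
    show ?thesis using solvable_hypergraph[OF assms] unfolding ncol_def k_def .
  qed
  define Ts where "Ts = map (\<lambda>i. {v \<in> {1..t}. i \<in> f v}) [0..<N]"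
  have union: "\<Union>(f ` S) = {i. i < N \<and> {v \<in> {1..t}. i \<in> f v} \<inter> S \<noteq> {}}" if "S \<in> gt_cands t 3" for S
    using that f_words by (fastforce simp: gt_cands_def words_def)
  have "solvable t (Suc 2) (length Ts + k) (gt_cands t 3)"
  proof (rule solvable_split)
    fix q
    define r where "r = {i. i < N \<and> q ! i}"
    have "S \<in> consistent r" if S: "S \<in> gt_cands t 3" "outcome Ts S = q" for S
    proof -
      have "q ! i \<longleftrightarrow> {v \<in> {1..t}. i \<in> f v} \<inter> S \<noteq> {}" if "i < N" for i
        using that unfolding S(2)[symmetric] outcome_def Ts_def by simp
      then have "\<Union>(f ` S) = r" unfolding union[OF S(1)] r_def by blast
      with S(1) show ?thesis by (simp add: consistent_def)
    qed
    then have "{S \<in> gt_cands t 3. outcome Ts S = q} \<subseteq> consistent r" by blast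
    then show "solvable t 2 k {S \<in> gt_cands t 3. outcome Ts S = q}"
      by (rule solvable_subset[OF H])
  qed (auto simp: Ts_def)
  \<comment> \<open>Two stages without tests extend the three stages to five.\<close>
  then have "solvable t (Suc (Suc (Suc 2))) (length Ts + k) (gt_cands t 3)"
    by (rule solvable_Suc[OF solvable_Suc])
  then show ?thesis by (simp add: Ts_def k_def numeral_eq_Suc del: solvable.simps)
qed

end

section \<open>Numerical estimates and the limit\<close>

text \<open>The odds \<open>\<lambda>\<close> of the overview are \<open>cr - 1\<close>, so that
  \<open>(1 + \<lambda>) ^ 3 = 2\<close>.\<close>

definition cr :: real where "cr = root 3 2"

lemma cr3: "cr ^ 3 = 2"
  unfolding cr_def by (simp add: real_root_pow_pos)

lemma cr_bounds: "1.2599 < cr" "cr < 1.26"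
proof -
  have "cr \<ge> 0" by (simp add: cr_def)
  moreover have "(1.2599::real) ^ 3 < cr ^ 3" "cr ^ 3 < (1.26::real) ^ 3"
    unfolding cr3 by (simp_all add: power3_eq_cube)
  ultimately show "1.2599 < cr" "cr < 1.26"
    using power_less_imp_less_base[of "1.2599" 3 cr] power_less_imp_less_base[of cr 3 "1.26"] by simp_all
qed

definition density :: real where "density = (cr - 1) / cr"

definition weight :: "nat \<Rightarrow> nat" where
  "weight N = nat \<lfloor>(real N + 1) * density\<rfloor>"

lemma binomial_weight: "cr ^ N \<le> (real N + 1) * (real (N choose weight N) * (cr - 1) ^ weight N)"
  using binomial_mode[of "cr - 1" "weight N" N] cr_bounds by (simp add: weight_def density_def)

lemma density_bounds: "0.2 \<le> density" "density \<le> 1/2"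
  using cr_bounds by (simp_all add: density_def field_simps)

lemma weight_lower: "N \<ge> 30 \<Longrightarrow> N \<le> 6 * weight N"
proof -
  assume N: "N \<ge> 30"
  have "(real N + 1) * 0.2 \<le> (real N + 1) * density"
    using density_bounds by (intro mult_left_mono) auto
  then have "(real N + 1) * 0.2 - 1 \<le> real (weight N)"
    unfolding weight_def by linarith
  moreover have "30 \<le> real N" using N by simp
  ultimately have "real N \<le> real (6 * weight N)" by (simp add: field_simps)
  then show ?thesis by (simp only: of_nat_le_iff)
qed

lemma weight_Suc: "weight (Suc N) \<le> Suc (weight N)"
proof -
  have "(real (Suc N) + 1) * density = (real N + 1) * density + density"
    by (simp add: algebra_simps)
  also have "\<dots> \<le> (real N + 1) * density + 1" using density_bounds by simp
  finally have "\<lfloor>(real (Suc N) + 1) * density\<rfloor> \<le> \<lfloor>(real N + 1) * density\<rfloor> + 1"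
    by linarith
  then show ?thesis unfolding weight_def by simp
qed

lemma weight_le: "weight N \<le> N"
proof (induction N)
  case 0
  have "\<lfloor>density\<rfloor> = 0" using density_bounds by linarith
  then show ?case by (simp add: weight_def)
qed (use weight_Suc le_trans in blast)

text \<open>Poisson tail for large expectations: \<open>(2 * \<mu>) ^ k / fact k\<close> is at most
  \<open>exp (2 * \<mu>)\<close>, and dividing by \<open>2 ^ k\<close> with
  \<open>8 * \<mu> \<le> k\<close> leaves at most \<open>2 powr (- 4 * \<mu>)\<close>. This beats
  the \<open>4 ^ N\<close> pairs of subsets of \<open>{..<N}\<close> in the union bound.\<close>

lemma large_deviation_bound:
  assumes "real N + 1 \<le> \<mu>" "8 * \<mu> \<le> real k" "j \<le> 4 ^ N"
  shows "real j * (\<mu> ^ k / fact k) \<le> 1/8"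
proof -
  have "(2 * \<mu>) ^ k / fact k \<le> exp (2 * \<mu>)" using assms by (intro pow_fact_le_exp) auto
  also have "\<dots> = exp 1 powr (2 * \<mu>)" by (simp add: powr_def)
  also have "\<dots> \<le> (2 powr 2) powr (2 * \<mu>)"
    using assms(1) exp_le by (intro powr_mono2) auto
  also have "\<dots> = 2 powr (4 * \<mu>)" by (simp only: powr_powr) simp
  finally have 1: "2 ^ k * (\<mu> ^ k / fact k) \<le> 2 powr (4 * \<mu>)" by (simp add: power_mult_distrib)
  have "2 powr (8 * \<mu>) \<le> 2 powr (real k)" using assms(2) by simp
  then have "2 powr (8 * \<mu>) * (\<mu> ^ k / fact k) \<le> 2 ^ k * (\<mu> ^ k / fact k)"
    using assms(1) by (intro mult_right_mono) (auto simp: powr_realpow)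
  with 1 have "2 powr (8 * \<mu>) * (\<mu> ^ k / fact k) \<le> 2 powr (4 * \<mu>)" by simp
  then have "\<mu> ^ k / fact k \<le> 2 powr (4 * \<mu>) / 2 powr (8 * \<mu>)"
    by (simp add: field_simps)
  also have "\<dots> = 2 powr (- 4 * \<mu>)" by (simp flip: powr_diff)
  also have "\<dots> \<le> 2 powr (- 4 * (real N + 1))" using assms(1) by (intro powr_mono) auto
  finally have 2: "\<mu> ^ k / fact k \<le> 2 powr (- 4 * (real N + 1))" .
  have "real j \<le> 4 ^ N" using assms(3) by (metis of_nat_le_iff of_nat_numeral of_nat_power)
  also have "(4::real) ^ N = (2 powr 2) powr real N" by (simp add: powr_realpow)
  also have "\<dots> = 2 powr (2 * real N)" by (simp only: powr_powr)
  finally have "real j * (\<mu> ^ k / fact k) \<le> 2 powr (2 * real N) * 2 powr (- 4 * (real N + 1))"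
    using 2 assms(1) by (intro mult_mono) auto
  also have "\<dots> = 2 powr (2 * real N - 4 * (real N + 1))" by (simp flip: powr_add)
  also have "\<dots> \<le> 2 powr (- 3)" by (intro powr_mono) auto
  also have "\<dots> = 1/8" by (simp add: powr_minus powr_numeral)
  finally show ?thesis .
qed

text \<open>When the expectation is \<open>0.997 ^ N\<close>, a constant \<open>k\<close> suffices:
  \<open>(0.997 ^ k) ^ N\<close> is at most \<open>(1/20) ^ N\<close>, which beats
  \<open>4 ^ N\<close>.\<close>

lemma small_deviation_bound:
  assumes "N \<ge> 2" "0.997 ^ k < (1/20 :: real)" "j \<le> 4 ^ N"
  shows "real j * ((0.997 ^ N) ^ k / fact k) \<le> 1/8"
proof -
  have "((0.997::real) ^ N) ^ k / fact k \<le> (0.997 ^ N) ^ k / 1"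
    by (intro divide_left_mono) (auto simp: fact_ge_1)
  also have "\<dots> = (0.997 ^ k) ^ N" by (simp add: mult.commute flip: power_mult)
  also have "\<dots> \<le> (1/20) ^ N" using assms(2) by (intro power_mono) auto
  finally have 1: "((0.997::real) ^ N) ^ k / fact k \<le> (1/20) ^ N" .
  have j: "real j \<le> 4 ^ N" using assms(3) by (metis of_nat_le_iff of_nat_numeral of_nat_power)
  have "real j * ((0.997 ^ N) ^ k / fact k) \<le> 4 ^ N * (1/20) ^ N"
    using 1 j by (intro mult_mono) auto
  also have "\<dots> = (1/5 :: real) ^ N" by (simp flip: power_mult_distrib)
  also have "\<dots> \<le> (1/5) ^ 2" using assms(1) by (intro power_decreasing) auto
  also have "\<dots> \<le> 1/8" by (simp add: power2_eq_square)
  finally show ?thesis .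
qed

text \<open>Factor \<open>1.025\<close>: a pair can be consistent with up to \<open>4 ^ w\<close> labels for the third element, and
  \<open>4 * (cr - 1)\<close> exceeds 1 slightly.  Since \<open>4 * (cr - 1) \<le> 1.025\<^sup>2\<close>, the expected pair degree still
  stays below the expected number \<open>1.025 ^ (3 * w)\<close> of consistent triples.\<close>

locale random_labels =
  fixes t N w :: nat
  assumes w: "w = weight N"
    and t_le: "real t \<le> cr ^ N * 1.025 ^ w"
    and N: "2 \<le> N"
    and N_large: "(real N + 1)\<^sup>2 * 0.98 ^ w \<le> 0.997 ^ N"
begin

section \<open>Expected numbers of matches under random labels\<close>

abbreviation "W \<equiv> words N w"

text \<open>Trading \<open>cr ^ N\<close> for \<open>card W * (cr - 1) ^ w\<close> costs only a
  factor \<open>N + 1\<close>, so later expectations are a polynomial times a \<open>w\<close>-th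
  power whose base decides.\<close>

lemma t_le_words: "real t \<le> (real N + 1) * real (card W) * ((cr - 1) * 1.025) ^ w"
proof -
  have "real t \<le> ((real N + 1) * (real (N choose w) * (cr - 1) ^ w)) * 1.025 ^ w"
    using t_le binomial_weight[of N] unfolding w
    by (meson mult_right_mono order.trans zero_le_numeral zero_le_power divide_nonneg_nonneg)
  then show ?thesis by (simp only: card_words power_mult_distrib mult_ac)
qed

lemma W_nonempty: "W \<noteq> {}"
proof
  assume "W = {}"
  then have "N choose weight N = 0" using card_words[of N w] unfolding w by (metis card.empty)
  then have "cr ^ N \<le> 0" using binomial_weight[of N] by (simp del: binomial_eq_0_iff)
  moreover have "0 < cr ^ N" using cr_bounds by simp
  ultimately show False by simp
qed

text \<open>The size of \<open>R\<close> is known with weight \<open>z\<close>, the ratio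
  \<open>t / card W\<close> with weight \<open>(cr - 1) * 1.025\<close>; passing from one weight to
  the other leaves a numerical condition on the base \<open>B\<close>.\<close>

lemma expected_matches:
  assumes "real (card R) * z ^ (m * w) \<le> C ^ w" "z > 0"
    "((cr - 1) * 1.025 / z) ^ m * C \<le> B" "C \<ge> 0"
  shows "real (card {1..t}) ^ m * real (card R) \<le> ((real N + 1) ^ m * B ^ w) * real (card W) ^ m"
proof -
  let ?l = "(cr - 1) * 1.025"
  have l: "0 \<le> ?l" using cr_bounds by simp
  have "real (card R) * ?l ^ (m * w) = (?l / z) ^ (m * w) * (real (card R) * z ^ (m * w))"
    using assms(2) by (simp add: power_divide)
  also have "\<dots> \<le> (?l / z) ^ (m * w) * C ^ w"
    using assms l by (intro mult_left_mono) auto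
  also have "\<dots> = ((?l / z) ^ m * C) ^ w" by (simp add: power_mult power_mult_distrib)
  also have "\<dots> \<le> B ^ w" using assms l by (intro power_mono) auto
  finally have R: "real (card R) * ?l ^ (m * w) \<le> B ^ w" .
  have "real t ^ m \<le> ((real N + 1) * real (card W) * ?l ^ w) ^ m"
    by (rule power_mono[OF t_le_words]) simp
  then have "real t ^ m * real (card R) \<le> ((real N + 1) * real (card W) * ?l ^ w) ^ m * real (card R)"
    by (rule mult_right_mono) simp
  also have "\<dots> = (real N + 1) ^ m * real (card W) ^ m * (real (card R) * ?l ^ (m * w))"
  proof -
    have "(a * b * c ^ w) ^ m * r = a ^ m * b ^ m * (r * c ^ (m * w))" for a b c r :: real
      by (simp add: power_mult_distrib mult.commute[of m w] power_mult)
    then show ?thesis .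
  qed
  also have "\<dots> \<le> (real N + 1) ^ m * real (card W) ^ m * B ^ w"
    using R by (intro mult_left_mono) auto
  finally show ?thesis by (simp only: card_atLeastAtMost) (simp add: mult_ac)
qed

lemma bad_bound:
  fixes R :: "nat set \<times> nat set \<Rightarrow> nat set list set"
  assumes "J \<subseteq> Pow {..<N} \<times> Pow {..<N}" "\<And>j. finite (R j)" "m > 0"
    and "\<And>j. j \<in> J \<Longrightarrow> real (card {1..t}) ^ m * real (card (R j)) \<le> \<mu> * real (card W) ^ m"
    and "\<And>j. j \<le> 4 ^ N \<Longrightarrow> real j * (\<mu> ^ k / fact k) \<le> 1/8"
  shows "real (card {f \<in> {1..t} \<rightarrow>\<^sub>E W. \<exists>j\<in>J. has_matching {1..t} m k (R j) f}) \<le> 1/8 * real (card W) ^ t"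
proof -
  have "card J \<le> card (Pow {..<N} \<times> Pow {..<N})" using assms(1) by (intro card_mono) auto
  also have "\<dots> = (2 * 2) ^ N" by (simp add: card_cartesian_product card_Pow flip: power_mult_distrib)
  finally have "card J \<le> 4 ^ N" by simp
  moreover have "finite J" using assms(1) by (rule finite_subset) simp
  ultimately show ?thesis
    using card_has_matching_family[of "{1..t}" W J R m \<mu> k "1/8"] assms W_nonempty by simp
qed

text \<open>With a base of at most \<open>0.98\<close>, \<open>N_large\<close> absorbs the
  polynomial factor; such expectations lead to the constant bound \<open>K\<close>, those of the
  next lemma to \<open>M\<close>.\<close>

lemma expected_far_matches:
  assumes "real (card R) * z ^ (m * w) \<le> C ^ w" "z > 0" "C \<ge> 0"
    "((cr - 1) * 1.025 / z) ^ m * C \<le> 0.98" "m \<le> 2"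
  shows "real (card {1..t}) ^ m * real (card R) \<le> 0.997 ^ N * real (card W) ^ m"
proof -
  have "(real N + 1) ^ m * 0.98 ^ w \<le> (real N + 1)\<^sup>2 * 0.98 ^ w"
    using assms by (intro mult_right_mono power_increasing) auto
  also note N_large
  finally have "(real N + 1) ^ m * 0.98 ^ w * real (card W) ^ m \<le> 0.997 ^ N * real (card W) ^ m"
    by (rule mult_right_mono) simp
  with expected_matches[OF assms(1,2,4,3)] show ?thesis by simp
qed

lemma expected_near_matches:
  assumes "real (card R) * z ^ (m * w) \<le> C ^ w" "z > 0" "C \<ge> 0"
    "((cr - 1) * 1.025 / z) ^ m * C \<le> 1.025 ^ 3" "m \<le> 3"
  shows "real (card {1..t}) ^ m * real (card R) \<le> ((real N + 1) ^ 3 * 1.025 ^ (3 * w)) * real (card W) ^ m"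
proof -
  have "(real N + 1) ^ m * (1.025 ^ 3) ^ w \<le> (real N + 1) ^ 3 * (1.025 ^ 3) ^ w"
    using assms by (intro mult_right_mono power_increasing) auto
  then have "(real N + 1) ^ m * (1.025 ^ 3) ^ w * real (card W) ^ m
      \<le> (real N + 1) ^ 3 * 1.025 ^ (3 * w) * real (card W) ^ m"
    unfolding power_mult by (rule mult_right_mono) simp
  with expected_matches[OF assms(1,2,4,3)] show ?thesis by simp
qed

abbreviation "\<mu> \<equiv> (real N + 1) ^ 3 * 1.025 ^ (3 * w)"

lemma cr_minus_1: "0 \<le> cr - 1" "cr - 1 \<le> 0.26"
  using cr_bounds by auto

text \<open>At \<open>z = cr - 1\<close> an index of \<open>r\<close> contributes
  \<open>(1 + z) ^ 3 - 1 = 1\<close>, so the base is exactly \<open>1.025 ^ 3\<close>.\<close>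

lemma expected_triples:
  assumes "r \<subseteq> {..<N}"
  shows "real (card {1..t}) ^ 3 * real (card (word_covers N w 3 {} r)) \<le> \<mu> * real (card W) ^ 3"
proof (rule expected_near_matches)
  show "real (card (word_covers N w 3 {} r)) * (cr - 1) ^ (3 * w) \<le> 1 ^ w"
    using card_word_covers_le[of "{}" N r "cr - 1" w 3] cr_bounds assms cr3 by simp
  have "(cr - 1) * 1.025 / (cr - 1) = 1.025"
    using cr_bounds by (intro nonzero_mult_div_cancel_left) simp
  then show "((cr - 1) * 1.025 / (cr - 1)) ^ 3 * 1 \<le> 1.025 ^ 3" by (simp only: mult_1_right)
qed (use cr_bounds in auto)

text \<open>The weights \<open>0.414\<close>, \<open>0.94 ^ 10\<close> and \<open>0.37\<close>, \<open>0.81 ^ 10\<close> below are close to optimal in the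
  generating function bounds; tenth powers absorb the threshold \<open>3/10\<close> of \<open>near_covers\<close>.\<close>

lemma expected_link_pairs:
  assumes "X \<in> W" "r \<subseteq> {..<N}"
  shows "real (card {1..t}) ^ 2 * real (card (word_covers N w 2 X r)) \<le> 0.997 ^ N * real (card W) ^ 2"
proof (rule expected_far_matches)
  have X: "X \<subseteq> {..<N}" "card X = w" using assms(1) by (auto simp: words_def)
  have "real (card (word_covers N w 2 X r)) * 0.414 ^ (2 * w)
      \<le> ((1 + 0.414)\<^sup>2) ^ card X * ((1 + 0.414)\<^sup>2 - 1) ^ card (r - X)"
    using X assms by (intro card_word_covers_le) auto
  \<comment> \<open>\<open>1.414\<^sup>2 - 1\<close> is just below 1, so the indices of
    \<open>r - X\<close> cost nothing.\<close>
  also have "\<dots> \<le> ((1 + 0.414)\<^sup>2) ^ card X * 1"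
    by (intro mult_left_mono power_le_one) (auto simp: power2_eq_square)
  finally show "real (card (word_covers N w 2 X r)) * 0.414 ^ (2 * w) \<le> ((1 + 0.414)\<^sup>2) ^ w"
    by (simp only: X mult_1_right)
  have "((cr - 1) * 1.025 / 0.414)\<^sup>2 * (1 + 0.414)\<^sup>2 \<le> (0.26 * 1.025 / 0.414)\<^sup>2 * (1 + 0.414)\<^sup>2"
    using cr_minus_1 by (intro mult_right_mono power_mono divide_right_mono) auto
  also have "\<dots> \<le> 0.98" by (simp add: power2_eq_square)
  finally show "((cr - 1) * 1.025 / 0.414)\<^sup>2 * (1 + 0.414)\<^sup>2 \<le> 0.98" .
qed auto

text \<open>A third label is \<open>r - X\<close> plus a subset of \<open>X\<close>, which leaves at
  most \<open>2 ^ card X\<close> choices; this is the generating function bound at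
  \<open>z = 1\<close>.\<close>

lemma expected_singles:
  assumes "X \<subseteq> {..<N}" "card X \<le> 2 * w" "r \<subseteq> {..<N}"
  shows "real (card {1..t}) ^ 1 * real (card (word_covers N w 1 X r)) \<le> \<mu> * real (card W) ^ 1"
proof (rule expected_near_matches)
  have "real (card (word_covers N w 1 X r)) \<le> 2 ^ card X"
    using card_word_covers_le[of X N r 1 w 1] assms by simp
  also have "\<dots> \<le> 2 ^ (2 * w)" using assms by (intro power_increasing) auto
  finally show "real (card (word_covers N w 1 X r)) * 1 ^ (1 * w) \<le> 4 ^ w" by (simp add: power_mult)
  have "((cr - 1) * 1.025 / 1) ^ 1 * 4 \<le> (0.26 * 1.025 / 1) ^ 1 * 4" using cr_minus_1 by simp
  also have "\<dots> \<le> 1.025 ^ 3" by (simp add: power3_eq_cube)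
  finally show "((cr - 1) * 1.025 / 1) ^ 1 * 4 \<le> 1.025 ^ 3" .
qed auto

text \<open>The third label must contain \<open>r - X\<close>, more than \<open>3 * w / 10\<close>
  indices; the factor \<open>0.94 ^ 10\<close> that each of them carries brings the base below
  1.\<close>

lemma expected_far_singles:
  assumes "X \<subseteq> {..<N}" "card X \<le> 2 * w" "r \<subseteq> {..<N}" "3 * w < 10 * card (r - X)"
  shows "real (card {1..t}) ^ 1 * real (card (word_covers N w 1 X r)) \<le> 0.997 ^ N * real (card W) ^ 1"
proof (rule expected_far_matches)
  let ?z = "0.94 ^ 10 :: real"
  have "real (card (word_covers N w 1 X r)) * ?z ^ (1 * w)
      \<le> ((1 + ?z) ^ 1) ^ card X * ((1 + ?z) ^ 1 - 1) ^ card (r - X)"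
    using assms by (intro card_word_covers_le) auto
  also have "\<dots> = (1 + ?z) ^ card X * 0.94 ^ (10 * card (r - X))"
    by (simp only: power_mult power_one_right add_diff_cancel_left')
  also have "\<dots> \<le> (1 + ?z) ^ (2 * w) * 0.94 ^ (3 * w)"
    using assms by (intro mult_mono[OF power_increasing power_decreasing]) auto
  also have "\<dots> = ((1 + ?z)\<^sup>2 * 0.94 ^ 3) ^ w" by (simp only: power_mult power_mult_distrib)
  finally show "real (card (word_covers N w 1 X r)) * ?z ^ (1 * w) \<le> ((1 + ?z)\<^sup>2 * 0.94 ^ 3) ^ w" .
  have "((cr - 1) * 1.025 / ?z) ^ 1 * ((1 + ?z)\<^sup>2 * 0.94 ^ 3)
      \<le> (0.26 * 1.025 / ?z) ^ 1 * ((1 + ?z)\<^sup>2 * 0.94 ^ 3)"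
    using cr_minus_1 by (intro mult_right_mono power_mono divide_right_mono) auto
  also have "\<dots> \<le> 0.98" by (simp add: eval_nat_numeral)
  finally show "((cr - 1) * 1.025 / ?z) ^ 1 * ((1 + ?z)\<^sup>2 * 0.94 ^ 3) \<le> 0.98" .
qed auto

lemma expected_near_pairs:
  assumes "r \<subseteq> {..<N}"
  shows "real (card {1..t}) ^ 2 * real (card (near_covers N w r)) \<le> 0.997 ^ N * real (card W) ^ 2"
proof (rule expected_far_matches)
  \<comment> \<open>\<open>1.37\<^sup>2 - 1 + 0.81 ^ 10\<close> is just below 1, as
    \<open>card_near_covers_le\<close> demands.\<close>
  have "real (card (near_covers N w r)) * (0.37 ^ (2 * w) * 0.81 ^ (3 * w)) \<le> 1"
    using assms by (intro card_near_covers_le) (auto simp: eval_nat_numeral)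
  then have "real (card (near_covers N w r)) * 0.37 ^ (2 * w) \<le> 1 / 0.81 ^ (3 * w)"
    by (subst pos_le_divide_eq) (simp_all only: mult.assoc, simp)
  then show "real (card (near_covers N w r)) * 0.37 ^ (2 * w) \<le> ((1 / 0.81) ^ 3) ^ w"
    by (simp only: power_divide power_one power_mult)
  have "((cr - 1) * 1.025 / 0.37)\<^sup>2 * (1 / 0.81) ^ 3 \<le> (0.26 * 1.025 / 0.37)\<^sup>2 * (1 / 0.81) ^ 3"
    using cr_minus_1 by (intro mult_right_mono power_mono divide_right_mono) auto
  also have "\<dots> \<le> 0.98" by (simp add: eval_nat_numeral)
  finally show "((cr - 1) * 1.025 / 0.37)\<^sup>2 * (1 / 0.81) ^ 3 \<le> 0.98" .
qed auto

text \<open>Each of the five assumptions of \<open>good_labels\<close> fails for at most one eighth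
  of all labellings, so some labelling satisfies them all.\<close>

lemma ex_good_labels:
  assumes K: "0.997 ^ K < (1/20 :: real)" and M: "8 * \<mu> \<le> real M"
  shows "\<exists>f. good_labels t N w K M f"
proof -
  let ?P = "Pow {..<N}" and ?A = "{1..t}"
  define bad where "bad m k J R = {f \<in> ?A \<rightarrow>\<^sub>E W. \<exists>j\<in>J. has_matching ?A m k (R j) f}"
    for m k J and R :: "nat set \<times> nat set \<Rightarrow> nat set list set"
  let ?R = "\<lambda>m j. word_covers N w m (fst j) (snd j)"
  let ?R' = "\<lambda>j. near_covers N w (snd j)"
  let ?J3 = "{{} :: nat set} \<times> ?P" and ?J2 = "W \<times> ?P"
  let ?J1 = "{X. X \<subseteq> {..<N} \<and> card X \<le> 2 * w} \<times> ?P"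
  let ?J1' = "{j \<in> ?J1. 3 * w < 10 * card (snd j - fst j)}"
  note small = small_deviation_bound[OF N K]
  have "real N + 1 \<le> (real N + 1) ^ 3 * 1"
    using power_increasing[of 1 3 "real N + 1"] by simp
  also have "\<dots> \<le> \<mu>" by (intro mult_left_mono one_le_power) auto
  finally have large: "real j * (\<mu> ^ M / fact M) \<le> 1/8" if "j \<le> 4 ^ N" for j
    using M that by (rule large_deviation_bound)
  have b3: "real (card (bad 3 M ?J3 (?R 3))) \<le> 1/8 * real (card W) ^ t"
    unfolding bad_def using large expected_triples by (intro bad_bound) auto
  have b2: "real (card (bad 2 K ?J2 (?R 2))) \<le> 1/8 * real (card W) ^ t"
    unfolding bad_def using small expected_link_pairs by (intro bad_bound) (auto simp: words_def)
  have b1: "real (card (bad 1 M ?J1 (?R 1))) \<le> 1/8 * real (card W) ^ t"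
    unfolding bad_def using large expected_singles by (intro bad_bound) auto
  have b1': "real (card (bad 1 K ?J1' (?R 1))) \<le> 1/8 * real (card W) ^ t"
    unfolding bad_def using small expected_far_singles by (intro bad_bound) auto
  have b2': "real (card (bad 2 K ?J3 ?R')) \<le> 1/8 * real (card W) ^ t"
    unfolding bad_def using small expected_near_pairs by (intro bad_bound) auto
  let ?B = "bad 3 M ?J3 (?R 3) \<union> bad 2 K ?J2 (?R 2) \<union> bad 1 M ?J1 (?R 1) \<union> bad 1 K ?J1' (?R 1)
    \<union> bad 2 K ?J3 ?R'"
  have Wt: "0 < real (card W) ^ t" using W_nonempty by (simp add: card_gt_0_iff)
  have "card ?B \<le> card (bad 3 M ?J3 (?R 3)) + card (bad 2 K ?J2 (?R 2)) + card (bad 1 M ?J1 (?R 1))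
      + card (bad 1 K ?J1' (?R 1)) + card (bad 2 K ?J3 ?R')"
    by (intro order.trans[OF card_Un_le] add_mono order.refl)
  then have "real (card ?B) \<le> real (card (bad 3 M ?J3 (?R 3)) + card (bad 2 K ?J2 (?R 2))
      + card (bad 1 M ?J1 (?R 1)) + card (bad 1 K ?J1' (?R 1)) + card (bad 2 K ?J3 ?R'))"
    by (simp only: of_nat_le_iff)
  also have "\<dots> \<le> 5/8 * real (card W) ^ t"
    unfolding of_nat_add using b3 b2 b1 b1' b2' by linarith
  also have "\<dots> < real (card W) ^ t" using Wt by simp
  also have "\<dots> = real (card (?A \<rightarrow>\<^sub>E W))" by (simp add: card_PiE)
  finally have lt: "card ?B < card (?A \<rightarrow>\<^sub>E W)" by (simp only: of_nat_less_iff)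
  have "finite (?A \<rightarrow>\<^sub>E W)" by (intro finite_PiE) auto
  then have "finite ?B" by (rule finite_subset[rotated]) (auto simp: bad_def)
  with lt have "\<not> ?A \<rightarrow>\<^sub>E W \<subseteq> ?B"
    using card_mono[of ?B "?A \<rightarrow>\<^sub>E W"] by linarith
  then obtain f where f: "f \<in> ?A \<rightarrow>\<^sub>E W" "f \<notin> ?B" by blast
  then have no: "j \<in> ?J3 \<Longrightarrow> \<not> has_matching ?A 3 M (?R 3 j) f"
    "j \<in> ?J2 \<Longrightarrow> \<not> has_matching ?A 2 K (?R 2 j) f"
    "j \<in> ?J1 \<Longrightarrow> \<not> has_matching ?A 1 M (?R 1 j) f"
    "j \<in> ?J1' \<Longrightarrow> \<not> has_matching ?A 1 K (?R 1 j) f"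
    "j \<in> ?J3 \<Longrightarrow> \<not> has_matching ?A 2 K (?R' j) f" for j
    unfolding bad_def by blast+
  have "good_labels t N w K M f"
  proof
    fix r assume r: "r \<subseteq> {..<N}"
    show "\<not> has_matching ?A 3 M (word_covers N w 3 {} r) f" using no(1)[of "({}, r)"] r by simp
    show "\<not> has_matching ?A 2 K (near_covers N w r) f" using no(5)[of "({}, r)"] r by simp
    fix X
    show "\<not> has_matching ?A 2 K (word_covers N w 2 X r) f" if "X \<in> W"
      using no(2)[of "(X, r)"] r that by simp
    assume X: "X \<subseteq> {..<N}" "card X \<le> 2 * w"
    then show "\<not> has_matching ?A 1 M (word_covers N w 1 X r) f" using no(3)[of "(X, r)"] r by simp
    show "\<not> has_matching ?A 1 K (word_covers N w 1 X r) f" if "3 * w < 10 * card (r - X)"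
      using no(4)[of "(X, r)"] X r that by simp
  qed (use f in simp)
  then show ?thesis by blast
qed

end

lemma eventually_N_large:
  "eventually (\<lambda>N. (real N + 1)\<^sup>2 * 0.98 ^ weight N \<le> 0.997 ^ N) at_top"
proof -
  have "eventually (\<lambda>N. (real N + 1)\<^sup>2 * 0.998 powr (real N / 6) \<le> 1) at_top"
    by real_asymp
  then show ?thesis
    using eventually_ge_at_top[of 30]
  proof eventually_elim
    case (elim N)
    let ?w = "weight N"
    have w: "real N / 6 \<le> real ?w" using weight_lower[OF elim(2)] by linarith
    \<comment> \<open>As \<open>N \<le> 6 * weight N\<close>, the factor \<open>0.997 ^ 6\<close>
      supplies \<open>0.997 ^ N\<close>, and the spare \<open>0.998\<close> absorbs
      \<open>(N + 1)\<^sup>2\<close>.\<close>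
    have "(0.98::real) ^ ?w \<le> (0.998 * 0.997 ^ 6) ^ ?w"
      by (intro power_mono) (auto simp: eval_nat_numeral)
    also have "\<dots> = 0.998 powr real ?w * 0.997 ^ (6 * ?w)"
    proof -
      have "(0.998::real) powr real ?w = 0.998 ^ ?w" by (simp add: powr_realpow)
      then show ?thesis by (simp only: power_mult_distrib power_mult)
    qed
    also have "\<dots> \<le> 0.998 powr (real N / 6) * 0.997 ^ N"
      using w weight_lower[OF elim(2)]
      by (intro mult_mono[OF powr_mono' power_decreasing]) auto
    finally have "(real N + 1)\<^sup>2 * 0.98 ^ ?w \<le> (real N + 1)\<^sup>2 * (0.998 powr (real N / 6) * 0.997 ^ N)"
      by (rule mult_left_mono) simp
    also have "\<dots> = ((real N + 1)\<^sup>2 * 0.998 powr (real N / 6)) * 0.997 ^ N" by simp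
    also have "\<dots> \<le> 1 * 0.997 ^ N" using elim(1) by (intro mult_right_mono) auto
    finally show ?case by simp
  qed
qed

section \<open>Label length for a given number of samples\<close>

definition capacity :: "nat \<Rightarrow> real" where
  "capacity N = cr ^ N * 1.025 ^ weight N"

lemma capacity_Suc: "capacity (Suc N) \<le> 2 * capacity N"
proof -
  have "(1.025::real) ^ weight (Suc N) \<le> 1.025 ^ Suc (weight N)"
    using weight_Suc by (intro power_increasing) auto
  then have "capacity (Suc N) \<le> (cr * cr ^ N) * (1.025 * 1.025 ^ weight N)"
    unfolding capacity_def power_Suc using cr_bounds by (intro mult_left_mono) auto
  also have "\<dots> = (cr * 1.025) * capacity N" by (simp add: capacity_def)
  also have "\<dots> \<le> 2 * capacity N"
    using cr_bounds by (intro mult_right_mono) (auto simp: capacity_def)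
  finally show ?thesis .
qed

lemma capacity_le: "capacity N \<le> 2 ^ N"
proof (induction N)
  case 0
  then show ?case using weight_le[of 0] by (simp add: capacity_def)
next
  case (Suc N)
  with capacity_Suc[of N] show ?case by simp
qed

lemma capacity_ge: "cr ^ N \<le> capacity N"
proof -
  have "cr ^ N * 1 \<le> cr ^ N * 1.025 ^ weight N"
    using cr_bounds by (intro mult_left_mono one_le_power) auto
  then show ?thesis by (simp add: capacity_def)
qed

text \<open>Take the least \<open>N\<close> whose capacity reaches \<open>t\<close>. Its predecessor
  fails and a step at most doubles the capacity; \<open>capacity N \<le> 2 ^ N\<close> forces
  \<open>N\<close> past \<open>N0\<close>.\<close>

lemma ex_capacity:
  assumes "2 ^ N0 < t"
  shows "\<exists>N\<ge>N0. real t \<le> capacity N \<and> capacity N \<le> 2 * real t"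
proof -
  have "\<exists>N. real t < cr ^ N" using cr_bounds by (intro real_arch_pow) auto
  then obtain N' where "real t < cr ^ N'" by auto
  then have ex: "real t \<le> capacity N'" using capacity_ge[of N'] by linarith
  define N where "N = (LEAST N. real t \<le> capacity N)"
  have N: "real t \<le> capacity N" unfolding N_def using ex by (rule LeastI)
  have "(2::real) ^ N0 < real t"
    using assms by (metis of_nat_less_iff of_nat_numeral of_nat_power)
  with N capacity_le[of N] have "(2::real) ^ N0 < 2 ^ N" by linarith
  then have "N0 < N" by simp
  then obtain P where P: "N = Suc P" by (cases N) auto
  then have "\<not> real t \<le> capacity P"
    unfolding N_def by (metis lessI not_less_Least)
  with capacity_Suc[of P] P have "capacity N \<le> 2 * real t" by simp
  with N \<open>N0 < N\<close> show ?thesis by (intro exI[of _ N]) auto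
qed

section \<open>Upper bound, lower bound and limit\<close>

lemma upper_bound:
  "\<exists>c. eventually (\<lambda>t. (\<exists>A k. gt_valid 5 t 3 A k) \<and>
     real (N_gt 5 t 3) \<le> c + 3 * log 2 (7 + 3 * log 2 (real t)) + 3 * log 2 (real t)) at_top"
proof -
  obtain K where K: "(0.997::real) ^ K < 1/20" using real_arch_pow_inv[of "1/20" "0.997::real"] by auto
  define c where "c = K * 2 + K * 2 * (K * 2) + (K * 2 * (K * 2) * 3) * (K * 2 * (K * 2) * 3) + 1"
  obtain N0 where N0: "\<And>N. N \<ge> N0 \<Longrightarrow> (real N + 1)\<^sup>2 * 0.98 ^ weight N \<le> 0.997 ^ N"
    using eventually_N_large unfolding eventually_at_top_linorder by auto
  have "(\<exists>A k. gt_valid 5 t 3 A k) \<and>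
     real (N_gt 5 t 3) \<le> (real c + 8) + 3 * log 2 (7 + 3 * log 2 (real t)) + 3 * log 2 (real t)"
    if t: "t > 2 ^ max N0 2" for t
  proof -
    obtain N where NB: "N \<ge> max N0 2" "real t \<le> capacity N" "capacity N \<le> 2 * real t"
      using ex_capacity[OF t] by auto
    interpret random_labels t N "weight N"
      using NB N0[of N] by unfold_locales (simp_all add: capacity_def)
    define M where "M = nat \<lceil>8 * \<mu>\<rceil>"
    define n where "n = nat \<lceil>log 2 (real M)\<rceil>"
    have mu: "1 \<le> \<mu>" by (intro mult_ge1_I one_le_power) auto
    have M: "8 * \<mu> \<le> real M" "real M \<le> 16 * \<mu>"
      unfolding M_def using mu by linarith+
    have Mpos: "real M \<ge> 1" using M mu by linarith
    then have logM: "0 \<le> log 2 (real M)" by simp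
    have "real M = 2 powr log 2 (real M)" using Mpos by simp
    also have "\<dots> \<le> 2 powr real n" unfolding n_def using logM by (intro powr_mono) linarith+
    also have "\<dots> = real (2 ^ n)" by (simp add: powr_realpow)
    finally have Mn: "M \<le> 2 ^ n" by (simp only: of_nat_le_iff)
    obtain f where "good_labels t N (weight N) K M f" using ex_good_labels[OF K M(1)] by auto
    then interpret good_labels t N "weight N" K M f .
    obtain A where A: "gt_valid 5 t 3 A (N + (c + n))"
      using solvable_imp_gt_valid[OF solvable_cands[OF Mn]] unfolding c_def by auto
    then have "N_gt 5 t 3 \<le> N + (c + n)" unfolding N_gt_def by (intro Least_le) auto
    then have "real (N_gt 5 t 3) \<le> real c + (real N + real n)"
      using of_nat_mono[of "N_gt 5 t 3" "N + (c + n)", where 'a = real] by simp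
    also have "real n \<le> 1 + log 2 (real M)" unfolding n_def using logM by linarith
    also have "log 2 (real M) \<le> log 2 (16 * \<mu>)" using M Mpos by simp
    also have "16 * \<mu> = 2 ^ 4 * ((real N + 1) ^ 3 * 1.025 ^ (3 * weight N))" by simp
    also have "log 2 \<dots> = 4 + 3 * log 2 (real N + 1) + log 2 (1.025 ^ (3 * weight N))"
    proof -
      have "log 2 (2 ^ 4 * (x ^ 3 * y)) = 4 + 3 * log 2 x + log 2 y" if "x > 0" "y > 0" for x y :: real
        using that by (simp only: log_mult log_nat_power zero_less_power zero_less_mult_iff) simp
      then show ?thesis by simp
    qed
    finally have 1: "real (N_gt 5 t 3) \<le> real c + 5 + 3 * log 2 (real N + 1)
        + (real N + log 2 (1.025 ^ (3 * weight N)))" by simp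
    \<comment> \<open>Since \<open>cr ^ 3 = 2\<close>, the cube of the capacity is
      \<open>2 ^ N\<close> times the exponential part of \<open>\<mu>\<close>. Hence
      \<open>N\<close> tests plus \<open>log 2 \<mu>\<close> more cost about
      \<open>3 * log 2 t\<close>: the source of the constant 3.\<close>
    have cap: "capacity N ^ 3 = 2 ^ N * 1.025 ^ (3 * weight N)"
    proof -
      have "(x ^ N * y ^ weight N) ^ 3 = (x ^ 3) ^ N * y ^ (3 * weight N)" for x y :: real
        by (simp add: power_mult_distrib mult.commute flip: power_mult)
      then show ?thesis unfolding capacity_def by (simp only: cr3)
    qed
    have tpos: "0 < real t" using t by (cases t) auto
    have "capacity N ^ 3 \<le> (2 * real t) ^ 3"
      using NB(2,3) tpos by (intro power_mono) auto
    also have "\<dots> = 2 ^ 3 * real t ^ 3" by (rule power_mult_distrib)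
    finally have cap_le: "2 ^ N * 1.025 ^ (3 * weight N) \<le> 2 ^ 3 * real t ^ 3" unfolding cap .
    have log_t: "log 2 (2 ^ 3 * real t ^ 3) = 3 + 3 * log 2 (real t)"
      using tpos by (simp only: log_mult log_nat_power zero_less_power zero_less_numeral) simp
    have "real N + log 2 (1.025 ^ (3 * weight N)) = log 2 (2 ^ N * 1.025 ^ (3 * weight N))"
      by (subst log_mult) (simp_all add: log_nat_power)
    also have "\<dots> \<le> 3 + 3 * log 2 (real t)"
      unfolding log_t[symmetric] using cap_le tpos by (intro log_mono) auto
    finally have 2: "real N + log 2 (1.025 ^ (3 * weight N)) \<le> 3 + 3 * log 2 (real t)" .
    \<comment> \<open>The same inequality bounds \<open>N\<close> by a multiple of
      \<open>log 2 t\<close>, so the polynomial factor of \<open>\<mu>\<close> costs only doubly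
      logarithmically many tests.\<close>
    have "0 \<le> log 2 (1.025 ^ (3 * weight N))" by simp
    with 2 have "real N + 1 \<le> 7 + 3 * log 2 (real t)" by linarith
    then have "log 2 (real N + 1) \<le> log 2 (7 + 3 * log 2 (real t))" by simp
    with 1 2 A show ?thesis by auto
  qed
  then show ?thesis
    by (intro exI[of _ "real c + 8"] eventually_mono[OF eventually_gt_at_top[of "2 ^ max N0 2"]]) auto
qed

lemma lower_bound:
  assumes "gt_valid p t 3 A k" "t \<ge> 3"
  shows "3 * log 2 (real t / 3) \<le> real (N_gt p t 3)"
proof -
  \<comment> \<open>\<open>N_gt\<close> is a \<open>LEAST\<close>; the given algorithm shows that
    the minimum is attained.\<close>
  have "\<exists>A. gt_valid p t 3 A (N_gt p t 3)"
    unfolding N_gt_def using assms(1) by (intro LeastI[of "\<lambda>k. \<exists>A. gt_valid p t 3 A k" k]) auto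
  then have "t choose 3 \<le> 2 ^ N_gt p t 3" using gt_valid_lower by blast
  then have 1: "real (t choose 3) \<le> 2 ^ N_gt p t 3"
    by (metis of_nat_le_iff of_nat_numeral of_nat_power)
  have "(real t / 3) ^ 3 \<le> real (t choose 3)"
    using binomial_ge_n_over_k_pow_k[of 3 t, where 'a = real] assms(2) by simp
  from order.trans[OF this 1] have "(real t / 3) ^ 3 \<le> 2 ^ N_gt p t 3" .
  then have "log 2 ((real t / 3) ^ 3) \<le> log 2 (2 ^ N_gt p t 3)"
    using assms(2) by (intro log_mono) auto
  then show ?thesis using assms(2) by (simp add: log_nat_power)
qed

theorem theorem2:
  shows "C_gt 5 3 = 3"
proof -
  define F where "F t = ereal (real (N_gt 5 t 3) / log 2 (real t))" for t
  obtain c where c: "eventually (\<lambda>t. (\<exists>A k. gt_valid 5 t 3 A k) \<and>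
     real (N_gt 5 t 3) \<le> c + 3 * log 2 (7 + 3 * log 2 (real t)) + 3 * log 2 (real t)) at_top"
    using upper_bound by blast
  define U where "U t = (c + 3 * log 2 (7 + 3 * log 2 (real t)) + 3 * log 2 (real t)) / log 2 (real t)" for t
  define L where "L t = 3 * log 2 (real t / 3) / log 2 (real t)" for t
  have "U \<longlonglongrightarrow> 3" unfolding U_def by real_asymp
  then have U: "limsup (\<lambda>t. ereal (U t)) = ereal 3"
    by (intro lim_imp_Limsup) auto
  have "L \<longlonglongrightarrow> 3" unfolding L_def by real_asymp
  then have L: "limsup (\<lambda>t. ereal (L t)) = ereal 3"
    by (intro lim_imp_Limsup) auto
  \<comment> \<open>The upper bound also supplies the valid algorithm that
    \<open>lower_bound\<close> asks for.\<close>
  have ev: "eventually (\<lambda>t. ereal (L t) \<le> F t \<and> F t \<le> ereal (U t)) at_top"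
    using c eventually_ge_at_top[of 3]
  proof eventually_elim
    case (elim t)
    then have pos: "0 < log 2 (real t)" by simp
    from elim obtain A k where "gt_valid 5 t 3 A k" by blast
    with elim(2) have "3 * log 2 (real t / 3) \<le> real (N_gt 5 t 3)" by (intro lower_bound)
    with pos elim(1) show ?case
      unfolding L_def U_def F_def by (auto intro: divide_right_mono)
  qed
  have "limsup F \<le> ereal 3"
    unfolding U[symmetric] by (intro Limsup_mono eventually_mono[OF ev]) auto
  moreover have "ereal 3 \<le> limsup F"
    unfolding L[symmetric] by (intro Limsup_mono eventually_mono[OF ev]) auto
  ultimately show ?thesis unfolding C_gt_def F_def by simp
qed

end
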